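(* Consider the Gaussian graphical model on the complete bipartite graph $K_{2,m}$ with vertex set $\{1,\dots,m+2\}$ and parts $\{1,2\}$ and $\{3,4,\dots,m+2\}$. Then: (1) for $n\ge 3$ observations the MLE exists with probability one; (2) for $n<2$ observations the MLE does not exist; (3) for $n=2$ observations $X_1,X_2\in\mathbb{R}^{m+2}$, let $X$ be the $(m+2)\times 2$ data matrix with columns $X_1,X_2$ and let $x_1,\dots,x_{m+2}\in\mathbb{R}^2$ be its rows. Then the MLE exists if and only if the lines generated by $x_1$ and $x_2$ are direct neighbors (among the lines generated by $x_1,\dots,x_{m+2}$).
   Context: For an undirected graph $G=([p],E)$, where $E$ is taken to contain all self-loops $(i,i)$, the (mean zero) Gaussian graphical model on $G$ is the family of distributions $\mathcal{N}(0,\Sigma)$ on $\mathbb{R}^p$ with $\Sigma$ symmetric positive definite and $(\Sigma^{-1})_{ij}=0$ for all $(i,j)\notin E$. Given observations $X_1,\dots,X_n\in\mathbb{R}^p$, the sample covariance matrix is $S=\frac1n\sum_{k=1}^n X_kX_k^T$ (the mean is known to be zero). The maximum likelihood estimator (MLE) of $\Sigma$ exists for these observations if the likelihood attains its maximum over the model; by a theorem of Dempster this holds if and only if there is a positive definite matrix $\hat\Sigma$ with $\hat\Sigma_{ij}=S_{ij}$ for all $(i,j)\in E$ (diagonal entries included). "The MLE exists with probability one for $n$ observations" means that it exists almost surely when $X_1,\dots,X_n$ are independent draws from a distribution in the model. Direct neighbors: the lines $\ell_1=\mathbb{R}x_1$ and $\ell_2=\mathbb{R}x_2$ through the origin of $\mathbb{R}^2$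 are direct neighbors if they are adjacent in the cyclic order of the lines $\mathbb{R}x_1,\dots,\mathbb{R}x_{m+2}$ by angle, with none of the other lines between them; that is, all the lines $\mathbb{R}x_3,\dots,\mathbb{R}x_{m+2}$ lie, apart from the origin, in one and the same pair of opposite open sectors of $\mathbb{R}^2\setminus(\ell_1\cup\ell_2)$. *)

theory Defs
  imports "HOL-Probability.Probability"
begin

definition pos_def :: "real ^ 'p ^ 'p \<Rightarrow> bool" where
  "pos_def A \<longleftrightarrow> transpose A = A \<and> (\<forall>x. x \<noteq> 0 \<longrightarrow> x \<bullet> (A *v x) > 0)"

text \<open>
  A graph on the vertex type \<open>'p\<close> is its set of edges, a symmetric set of ordered pairs
  containing all self-loops.  A mean zero Gaussian model is represented by its set of covariance
  matrices.
\<close>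

definition gaussian_graphical_model :: "('p::finite \<times> 'p) set \<Rightarrow> (real ^ 'p ^ 'p) set" where
  "gaussian_graphical_model E =
     {S. pos_def S \<and> (\<forall>i j. (i, j) \<notin> E \<longrightarrow> matrix_inv S $ i $ j = 0)}"

definition complete_bipartite :: "'p set \<Rightarrow> 'p set \<Rightarrow> ('p \<times> 'p) set" where
  "complete_bipartite A B = Id \<union> A \<times> B \<union> B \<times> A"

definition mvn_density :: "real ^ 'p ^ 'p \<Rightarrow> real ^ 'p \<Rightarrow> real" where
  "mvn_density S x =
     exp (- (x \<bullet> (matrix_inv S *v x)) / 2) / sqrt ((2 * pi) ^ CARD('p) * det S)"

text \<open>The observations are \<open>X 1, \<dots>, X n\<close>; other values of \<open>X\<close> are irrelevant.\<close>

definition likelihood :: "nat \<Rightarrow> (nat \<Rightarrow> real ^ 'p) \<Rightarrow> real ^ 'p ^ 'p \<Rightarrow> real" where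
  "likelihood n X S = (\<Prod>k=1..n. mvn_density S (X k))"

definition mle_exists :: "('p::finite \<times> 'p) set \<Rightarrow> nat \<Rightarrow> (nat \<Rightarrow> real ^ 'p) \<Rightarrow> bool" where
  "mle_exists E n X \<longleftrightarrow>
     (\<exists>S \<in> gaussian_graphical_model E. \<forall>T \<in> gaussian_graphical_model E.
        likelihood n X T \<le> likelihood n X S)"

definition data_matrix2 :: "(nat \<Rightarrow> real ^ 'p) \<Rightarrow> real ^ 2 ^ 'p" where
  "data_matrix2 X = (\<chi> i. vector [X 1 $ i, X 2 $ i])"

definition is_line :: "(real ^ 2) set \<Rightarrow> bool" where
  "is_line l \<longleftrightarrow> subspace l \<and> dim l = 1"

text \<open>
  The set \<open>L\<close> consists of the lines other than \<open>l1\<close> and \<open>l2\<close> in the family (one of them may still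
  coincide with \<open>l1\<close> or \<open>l2\<close>, which makes the predicate false).  The open sectors are the
  connected components of the complement of \<open>l1 \<union> l2\<close>; the sector opposite to \<open>C\<close> is \<open>- C\<close>.
  If \<open>l1 = l2\<close>, the two open half planes form the only pair of opposite sectors.
  The span of the zero vector is not a line and is excluded.
\<close>

definition direct_neighbors ::
    "(real ^ 2) set \<Rightarrow> (real ^ 2) set \<Rightarrow> (real ^ 2) set set \<Rightarrow> bool" where
  "direct_neighbors l1 l2 L \<longleftrightarrow>
     is_line l1 \<and> is_line l2 \<and> (\<forall>l\<in>L. is_line l) \<and>
     (\<exists>C \<in> components (- (l1 \<union> l2)). \<forall>l\<in>L. l - {0} \<subseteq> C \<union> uminus ` C)"

end

theory Submission
  imports Defs "HOL-Real_Asymp.Real_Asymp"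
begin

text \<open>
  In terms of the precision matrix \<open>K\<close>, maximizing the likelihood means maximizing
  \<open>det K ^ n * exp (- (K \<bullet> G))\<close>, where \<open>G\<close> is the unnormalized sample covariance and \<open>K\<close> is
  positive definite and vanishes off the graph.  If \<open>G\<close> has a positive definite completion \<open>A\<close>, then
  \<open>K \<bullet> G = K \<bullet> A\<close> dominates a multiple of the trace of \<open>K\<close>, and compactness gives a maximum.  If a
  nonzero positive semidefinite \<open>H\<close> with the pattern of the graph has \<open>H \<bullet> G = 0\<close>, then \<open>K + H\<close> is
  always better than \<open>K\<close>, and there is no maximum.

  For the complete bipartite graph with small part \<open>{a, b}\<close>, a completion exists as soon as a single
  value for the entry \<open>(a, b)\<close> makes all the blocks on \<open>{a, b, j}\<close> positive definite.  For at least
  three generic observations the Gram value itself works.  For two observations the blocks of the Gram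
  matrix are singular, and the direction in which the entry must be moved is the sign of
  \<open>det (x\<^sub>a, x\<^sub>j) * det (x\<^sub>b, x\<^sub>j)\<close>, which tells in which pair of opposite sectors \<open>x\<^sub>j\<close> lies.  If two
  of the signs differ or one of them is zero, then linear relations between the rows provide \<open>H\<close>.
\<close>

section \<open>Positive definite matrices\<close>

lemma matrix_inv_inverse:
  fixes A :: "real ^ 'p ^ 'p"
  assumes "invertible A"
  shows "A ** matrix_inv A = mat 1" "matrix_inv A ** A = mat 1"
  using assms unfolding invertible_def matrix_inv_def by (metis (mono_tags, lifting) someI_ex)+

lemma matrix_inv_eqI:
  fixes A B :: "real ^ 'p ^ 'p"
  assumes "A ** B = mat 1"
  shows "matrix_inv A = B"
  by (metis assms invertible_right_inverse matrix_inv_inverse(2) matrix_mul_assoc matrix_mul_lid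
      matrix_mul_rid)

lemma pos_def_invertible:
  fixes A :: "real ^ 'p ^ 'p"
  assumes "pos_def A"
  shows "invertible A"
proof -
  have "x = 0" if "A *v x = 0" for x
    using assms that unfolding pos_def_def by (metis inner_zero_right less_irrefl)
  then show ?thesis
    using matrix_left_invertible_ker invertible_left_inverse by blast
qed

lemma pos_def_matrix_inv:
  fixes A :: "real ^ 'p ^ 'p"
  assumes "pos_def A"
  shows "pos_def (matrix_inv A)" "matrix_inv (matrix_inv A) = A"
proof -
  note inv = matrix_inv_inverse[OF pos_def_invertible[OF assms]]
  have sym: "transpose A = A" using assms by (simp add: pos_def_def)
  have "transpose (matrix_inv A) ** A = mat 1"
    by (metis inv(1) matrix_transpose_mul sym transpose_mat)
  then have symi: "transpose (matrix_inv A) = matrix_inv A"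
    by (metis inv(1) matrix_mul_assoc matrix_mul_lid matrix_mul_rid)
  have "x \<bullet> (matrix_inv A *v x) > 0" if "x \<noteq> 0" for x
  proof -
    define y where "y = matrix_inv A *v x"
    have x: "x = A *v y" by (simp add: y_def matrix_vector_mul_assoc inv)
    then have "y \<noteq> 0" using that by auto
    then have "y \<bullet> (A *v y) > 0" using assms by (simp add: pos_def_def)
    then show ?thesis by (metis inner_commute x y_def)
  qed
  then show "pos_def (matrix_inv A)" using symi by (simp add: pos_def_def)
  show "matrix_inv (matrix_inv A) = A" by (rule matrix_inv_eqI[OF inv(2)])
qed

lemma transpose_eq_iff_nth: "transpose A = A \<longleftrightarrow> (\<forall>i j. A $ i $ j = A $ j $ i)"
  by (auto simp: transpose_def vec_eq_iff)

lemma pos_def_mat_1: "pos_def (mat 1 :: real ^ 'p ^ 'p)"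
  by (auto simp: pos_def_def)

lemma continuous_on_det [continuous_intros]:
  fixes f :: "'a::topological_space \<Rightarrow> real ^ 'p ^ 'p"
  assumes "continuous_on S f"
  shows "continuous_on S (\<lambda>x. det (f x))"
  unfolding det_def using assms
  by (intro continuous_intros)

text \<open>The segment from \<open>A\<close> to the identity stays positive definite, hence
  invertible, so by the intermediate value theorem the determinant cannot start at or below zero and
  end at 1.\<close>

lemma pos_def_det_pos:
  fixes A :: "real ^ 'p ^ 'p"
  assumes "pos_def A"
  shows "det A > 0"
proof (rule ccontr)
  assume neg: "\<not> det A > 0"
  define f where "f t = det ((1 - t) *\<^sub>R A + t *\<^sub>R mat 1)" for t :: real
  have "continuous_on {0..1} f" unfolding f_def by (intro continuous_intros)
  moreover have "f 0 \<le> 0" "0 \<le> f 1" using neg by (auto simp: f_def)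
  ultimately obtain t where t: "0 \<le> t" "t \<le> 1" "f t = 0"
    using IVT'[of f 0 0 1] by auto
  have "pos_def ((1 - t) *\<^sub>R A + t *\<^sub>R mat 1)"
  proof -
    have "x \<bullet> (((1 - t) *\<^sub>R A + t *\<^sub>R mat 1) *v x) > 0" if "x \<noteq> 0" for x
    proof -
      have "x \<bullet> (A *v x) > 0" "x \<bullet> x > 0" using assms that by (auto simp: pos_def_def)
      then have "(1 - t) * (x \<bullet> (A *v x)) + t * (x \<bullet> x) > 0"
        using t by (cases "t = 0") (auto intro: add_nonneg_pos)
      then show ?thesis
        by (simp add: matrix_vector_mult_add_rdistrib inner_add_right
            flip: scaleR_matrix_vector_assoc)
    qed
    moreover have "transpose ((1 - t) *\<^sub>R A + t *\<^sub>R mat 1) = (1 - t) *\<^sub>R A + t *\<^sub>R mat 1"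
      using assms by (simp add: pos_def_def transpose_eq_iff_nth mat_def)
    ultimately show ?thesis by (simp add: pos_def_def)
  qed
  then have "f t \<noteq> 0"
    using pos_def_invertible invertible_det_nz unfolding f_def by blast
  then show False using t by simp
qed

section \<open>Determinants of rank-one updates\<close>

definition outer :: "real ^ 'p \<Rightarrow> real ^ 'p ^ 'p" where
  "outer z = (\<chi> i j. z $ i * z $ j)"

lemma outer_nth [simp]: "outer z $ i $ j = z $ i * z $ j"
  by (simp add: outer_def)

lemma outer_mult_vec: "outer z *v x = (z \<bullet> x) *\<^sub>R z"
  by (simp add: vec_eq_iff matrix_vector_mult_def inner_vec_def sum_distrib_left
      sum_distrib_right ac_simps)

lemma inner_outer:
  fixes A :: "real ^ 'p ^ 'p"
  shows "A \<bullet> outer x = x \<bullet> (A *v x)"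
  by (simp add: inner_vec_def matrix_vector_mult_def sum_distrib_left ac_simps)

text \<open>With \<open>v\<close> standing in row \<open>k\<close>, the changes in the other rows
  are row operations by multiples of row \<open>k\<close>.\<close>

lemma det_add_rank_one_row:
  fixes A :: "real ^ 'p ^ 'p" and u v :: "real ^ 'p"
  assumes "finite R" "k \<notin> R"
  shows "det (\<chi> i. if i = k then v else if i \<in> R then row i A + u $ i *s v else row i A) =
         det (\<chi> i. if i = k then v else row i A)"
  using assms
proof (induction R rule: finite_induct)
  case empty
  have "(\<chi> i. if i = k then v else if i \<in> {} then row i A + u $ i *s v else row i A) =
      (\<chi> i. if i = k then v else row i A)" by (simp add: vec_eq_iff)
  then show ?case by simp
next
  case (insert r R)
  define B where "B = (\<chi> i. if i = k then v else if i \<in> R then row i A + u $ i *s v else row i A)"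
  have rk: "r \<noteq> k" using insert by auto
  have "(\<chi> i. if i = k then v else if i \<in> insert r R then row i A + u $ i *s v else row i A) =
      (\<chi> i. if i = r then row r B + u $ r *s row k B else row i B)"
    using insert.hyps rk by (auto simp: B_def vec_eq_iff row_def)
  then show ?case
    using det_row_operation[OF rk, of B "u $ r"] insert by (simp add: B_def)
qed

text \<open>Matrix determinant lemma for the identity. Rows are perturbed one at a time: linearity
  in row \<open>k\<close> splits off \<open>u $ k\<close> times a determinant with row
  \<open>k\<close> equal to \<open>v\<close>, in which the earlier perturbations are undone by row
  operations.\<close>

lemma det_add_rank_one:
  fixes u v :: "real ^ 'p"
  shows "det (\<chi> i j. (mat 1 :: real ^ 'p ^ 'p) $ i $ j + u $ i * v $ j) = 1 + u \<bullet> v"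
proof -
  let ?I = "mat 1 :: real ^ 'p ^ 'p"
  have step: "det (\<chi> i. if i = k then v else row i ?I) = v $ k" for k
  proof -
    have "v = (\<Sum>i\<in>UNIV. v $ i *s row i ?I)"
      by (simp add: vec_eq_iff row_def mat_def if_distrib sum.delta cong: if_cong)
    then show ?thesis
      using cramer_lemma_transpose[of k v ?I] by (metis det_I mult.right_neutral)
  qed
  have "det (\<chi> i. if i \<in> R then row i ?I + u $ i *s v else row i ?I) = 1 + (\<Sum>i\<in>R. u $ i * v $ i)"
    if "finite R" for R
    using that
  proof (induction R rule: finite_induct)
    case empty
    have "(\<chi> i. row i ?I) = ?I" by (simp add: vec_eq_iff row_def)
    then show ?case by simp
  next
    case (insert k R)
    let ?c = "\<lambda>i. if i \<in> R then row i ?I + u $ i *s v else row i ?I"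
    have "(\<chi> i. if i \<in> insert k R then row i ?I + u $ i *s v else row i ?I) =
      (\<chi> i. if i = k then row k ?I + u $ k *s v else ?c i)"
      by (auto simp: vec_eq_iff)
    also have "det \<dots> = det (\<chi> i. if i = k then row k ?I else ?c i) +
        u $ k * det (\<chi> i. if i = k then v else ?c i)"
      using det_row_add[of k "\<lambda>_. row k ?I" "\<lambda>_. u $ k *s v" ?c] det_row_mul[of k "u $ k" "\<lambda>_. v" ?c] by simp
    also have "(\<chi> i. if i = k then row k ?I else ?c i) = (\<chi> i. ?c i)"
      using insert by (auto simp: vec_eq_iff)
    finally show ?case
      using insert det_add_rank_one_row[of R k v ?I u] step[of k] by simp
  qed
  from this[of UNIV] have "det (\<chi> i. row i ?I + u $ i *s v) = 1 + u \<bullet> v"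
    by (simp add: inner_vec_def)
  moreover have "(\<chi> i. row i ?I + u $ i *s v) = (\<chi> i j. ?I $ i $ j + u $ i * v $ j)"
    by (simp add: vec_eq_iff row_def)
  ultimately show ?thesis by simp
qed

lemma pos_def_add_outer:
  fixes K :: "real ^ 'p ^ 'p"
  assumes "pos_def K"
  shows "pos_def (K + outer z)"
proof -
  have "x \<bullet> ((K + outer z) *v x) = x \<bullet> (K *v x) + (z \<bullet> x)\<^sup>2" for x
    by (simp add: matrix_vector_mult_add_rdistrib inner_add_right outer_mult_vec
        power2_eq_square inner_commute)
  moreover have "transpose (K + outer z) = K + outer z"
    using assms by (simp add: pos_def_def transpose_eq_iff_nth)
  ultimately show ?thesis
    using assms by (auto simp: pos_def_def intro: add_pos_nonneg)
qed

text \<open>With \<open>u = matrix_inv K *v z\<close>, the matrix \<open>K + outer z\<close> factors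
  as \<open>K\<close> times the identity plus the rank-one matrix with entries
  \<open>u $ i * z $ j\<close>.\<close>

lemma det_add_outer:
  fixes K :: "real ^ 'p ^ 'p"
  assumes "invertible K"
  shows "det (K + outer z) = det K * (1 + z \<bullet> (matrix_inv K *v z))"
proof -
  define u where "u = matrix_inv K *v z"
  define B :: "real ^ 'p ^ 'p" where "B = (\<chi> i j. mat 1 $ i $ j + u $ i * z $ j)"
  have "K *v u = z" by (simp add: u_def matrix_vector_mul_assoc matrix_inv_inverse assms)
  then have z: "z $ i = (\<Sum>k\<in>UNIV. K $ i $ k * u $ k)" for i
    by (auto simp: matrix_vector_mult_def)
  have "K ** B = K + outer z"
  proof -
    have "(K ** B) $ i $ j = (\<Sum>k\<in>UNIV. K $ i $ k * mat 1 $ k $ j) + (\<Sum>k\<in>UNIV. K $ i $ k * u $ k) * z $ j" for i j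
      by (simp add: matrix_matrix_mult_def B_def distrib_left sum.distrib sum_distrib_right mult.assoc)
    then show ?thesis
      by (simp add: vec_eq_iff z[symmetric] mat_def if_distrib cong: if_cong)
  qed
  then have "det (K + outer z) = det K * det B" by (metis det_mul)
  then show ?thesis by (simp add: B_def det_add_rank_one u_def[symmetric] inner_commute)
qed

lemma det_add_outer_less:
  fixes K :: "real ^ 'p ^ 'p"
  assumes "pos_def K" "z \<noteq> 0"
  shows "det K < det (K + outer z)"
proof -
  have "z \<bullet> (matrix_inv K *v z) > 0"
    using pos_def_matrix_inv(1)[OF assms(1)] assms(2) unfolding pos_def_def by blast
  then show ?thesis
    using pos_def_det_pos[OF assms(1)] det_add_outer[OF pos_def_invertible[OF assms(1)], of z]
    by (simp add: distrib_left)
qed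

section \<open>Positive semidefinite matrices\<close>

definition pos_semidef :: "real ^ 'p ^ 'p \<Rightarrow> bool" where
  "pos_semidef A \<longleftrightarrow> transpose A = A \<and> (\<forall>x. x \<bullet> (A *v x) \<ge> 0)"

lemma pos_def_imp_pos_semidef: "pos_def A \<Longrightarrow> pos_semidef A"
  unfolding pos_def_def pos_semidef_def by (metis inner_zero_left less_imp_le order_refl)

lemma pos_semidef_sym: "pos_semidef A \<Longrightarrow> A $ i $ j = A $ j $ i"
  by (simp add: pos_semidef_def transpose_eq_iff_nth)

text \<open>If the form vanished at \<open>x\<close> while \<open>y = A *v x\<close> is nonzero, its
  value at \<open>x + t y\<close> would be \<open>2 t |y|^2\<close> up to second order in
  \<open>t\<close>, hence negative for some negative \<open>t\<close>.\<close>

lemma pos_semidef_invertible_imp_pos_def: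
  fixes A :: "real ^ 'p ^ 'p"
  assumes "pos_semidef A" "det A \<noteq> 0"
  shows "pos_def A"
proof -
  have sym: "x \<bullet> (A *v y) = y \<bullet> (A *v x)" for x y
    using assms(1) by (metis dot_lmul_matrix inner_commute pos_semidef_def transpose_matrix_vector)
  have "x \<bullet> (A *v x) > 0" if x: "x \<noteq> 0" for x
  proof (rule ccontr)
    assume "\<not> x \<bullet> (A *v x) > 0"
    then have q0: "x \<bullet> (A *v x) = 0"
      using assms(1) by (meson antisym_conv1 linorder_neqE_linordered_idom not_less pos_semidef_def)
    define y where "y = A *v x"
    have lin: "0 \<le> 2 * t * (y \<bullet> y) + t\<^sup>2 * (y \<bullet> (A *v y))" for t
    proof -
      have "0 \<le> (x + t *\<^sub>R y) \<bullet> (A *v (x + t *\<^sub>R y))"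
        using assms(1) by (simp add: pos_semidef_def)
      also have "\<dots> = 2 * t * (y \<bullet> y) + t\<^sup>2 * (y \<bullet> (A *v y))"
        using q0 sym[of x y] by (simp add: matrix_vector_right_distrib matrix_vector_mult_scaleR
            inner_add_left inner_add_right y_def power2_eq_square algebra_simps)
      finally show ?thesis .
    qed
    have "invertible A" using assms(2) invertible_det_nz by blast
    then have "y \<noteq> 0"
      using x unfolding y_def
      by (metis invertible_left_inverse matrix_left_invertible_ker)
    then have yy: "y \<bullet> y > 0" by simp
    \<comment> \<open>The summand 1 makes \<open>c\<close> positive; the \<open>t\<close> used
      below, \<open>- (y . y) / c\<close>, minimizes the upper bound
      \<open>2 t |y|^2 + t^2 c\<close>.\<close>
    define c where "c = y \<bullet> (A *v y) + 1"
    have c: "c > 0" "y \<bullet> (A *v y) < c"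
      using assms(1) by (auto simp: c_def pos_semidef_def add_nonneg_pos)
    have "2 * (- (y \<bullet> y) / c) * (y \<bullet> y) + (- (y \<bullet> y) / c)\<^sup>2 * (y \<bullet> (A *v y))
        \<le> 2 * (- (y \<bullet> y) / c) * (y \<bullet> y) + (- (y \<bullet> y) / c)\<^sup>2 * c"
      using c by (intro add_left_mono mult_left_mono) auto
    also have "\<dots> = - ((y \<bullet> y)\<^sup>2 / c)"
      using c by (simp add: field_simps power2_eq_square)
    also have "\<dots> < 0" using yy c by simp
    finally show False using lin[of "- (y \<bullet> y) / c"] by simp
  qed
  then show ?thesis using assms(1) by (simp add: pos_def_def pos_semidef_def)
qed

lemma axis_mult_vec:
  fixes A :: "real ^ 'p ^ 'p"
  shows "axis i 1 \<bullet> (A *v x) = A $ i \<bullet> x"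
  by (simp add: inner_axis' matrix_vector_mul_component)

lemma pos_semidef_diag_nonneg:
  fixes A :: "real ^ 'p ^ 'p"
  assumes "pos_semidef A"
  shows "A $ i $ i \<ge> 0"
proof -
  have "A $ i \<bullet> axis i 1 \<ge> 0"
    using assms unfolding pos_semidef_def axis_mult_vec[symmetric] by blast
  then show ?thesis by (simp add: inner_axis)
qed

text \<open>The form is tested on the sum and the difference of two unit vectors.\<close>

lemma pos_semidef_entry_bound:
  fixes A :: "real ^ 'p ^ 'p"
  assumes "pos_semidef A"
  shows "\<bar>A $ i $ j\<bar> \<le> (A $ i $ i + A $ j $ j) / 2"
proof -
  have "0 \<le> A $ i $ i + A $ j $ j + 2 * s * A $ i $ j" if "s\<^sup>2 = 1" for s
  proof -
    let ?x = "axis i 1 + s *\<^sub>R axis j 1 :: real ^ 'p"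
    have "0 \<le> ?x \<bullet> (A *v ?x)" using assms by (simp add: pos_semidef_def)
    also have "\<dots> = A $ i $ i + s\<^sup>2 * A $ j $ j + s * A $ i $ j + s * A $ j $ i"
      by (simp add: matrix_vector_right_distrib matrix_vector_mult_scaleR inner_add_left
          inner_add_right axis_mult_vec inner_axis power2_eq_square algebra_simps)
    finally show ?thesis using that pos_semidef_sym[OF assms, of i j] by simp
  qed
  from this[of 1] this[of "-1"] show ?thesis by (simp add: abs_le_iff)
qed

text \<open>Symmetric Gaussian elimination: each step clears one nonzero diagonal entry.\<close>

lemma pos_semidef_eq_sum_outer:
  fixes A :: "real ^ 'p ^ 'p"
  assumes "pos_semidef A"
  shows "\<exists>ws. A = sum_list (map outer ws)"
  using assms
proof (induction "card {i. A $ i $ i \<noteq> 0}" arbitrary: A rule: less_induct)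
  case (less A)
  show ?case
  proof (cases "\<exists>i. A $ i $ i \<noteq> 0")
    case False
    then have "A = 0"
      using pos_semidef_entry_bound[OF less.prems] by (simp add: vec_eq_iff)
    then show ?thesis by (intro exI[of _ "[]"]) simp
  next
    case True
    then obtain i where i: "A $ i $ i \<noteq> 0" by blast
    define d where "d = A $ i $ i"
    have d: "d > 0" using i pos_semidef_diag_nonneg[OF less.prems, of i] by (simp add: d_def)
    \<comment> \<open>The scaling makes \<open>outer z\<close> agree with \<open>A\<close> in row
      and column \<open>i\<close>, so \<open>A'\<close> is the Schur complement bordered by
      zeros.\<close>
    define z where "z = (1 / sqrt d) *\<^sub>R (A $ i)"
    define A' where "A' = A - outer z"
    have A'_nth: "A' $ k $ l = A $ k $ l - A $ i $ k * A $ i $ l / d" for k l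
      using d by (simp add: A'_def z_def)
    have "pos_semidef A'"
    proof -
      have "x \<bullet> (A' *v x) \<ge> 0" for x
      proof -
        \<comment> \<open>This \<open>t\<close> minimizes the form of \<open>A\<close> on the line
          through \<open>x\<close> in direction \<open>axis i 1\<close>; the minimum is the form of
          \<open>A'\<close> at \<open>x\<close>.\<close>
        define t where "t = A $ i \<bullet> x / d"
        have Ai: "x \<bullet> (A *v axis i 1) = A $ i \<bullet> x"
          using less.prems by (metis axis_mult_vec dot_lmul_matrix inner_commute pos_semidef_def
              transpose_matrix_vector)
        have "0 \<le> (x - t *\<^sub>R axis i 1) \<bullet> (A *v (x - t *\<^sub>R axis i 1))"
          using less.prems by (simp add: pos_semidef_def)
        also have "\<dots> = x \<bullet> (A *v x) - 2 * t * (A $ i \<bullet> x) + t\<^sup>2 * d"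
          by (simp add: matrix_vector_mult_diff_distrib matrix_vector_mult_scaleR inner_diff_left
              inner_diff_right axis_mult_vec Ai inner_axis d_def power2_eq_square algebra_simps)
        also have "\<dots> = x \<bullet> (A *v x) - (A $ i \<bullet> x)\<^sup>2 / d"
          using d by (simp add: t_def field_simps power2_eq_square)
        also have "\<dots> = x \<bullet> (A' *v x)"
          using d by (simp add: A'_def matrix_vector_mult_diff_rdistrib inner_diff_right
              outer_mult_vec z_def inner_commute power2_eq_square)
        finally show ?thesis .
      qed
      moreover have "transpose A' = A'"
        using pos_semidef_sym[OF less.prems] by (simp add: transpose_eq_iff_nth A'_nth mult.commute)
      ultimately show ?thesis by (simp add: pos_semidef_def)
    qed
    moreover have "card {k. A' $ k $ k \<noteq> 0} < card {k. A $ k $ k \<noteq> 0}"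
    proof (rule psubset_card_mono)
      \<comment> \<open>Here the entry of \<open>A'\<close> is minus a square over \<open>d\<close>,
        yet it is nonnegative. So zero diagonal entries persist, and entry \<open>i\<close> joins
        them.\<close>
      have "A' $ k $ k = 0" if "A $ k $ k = 0" for k
        using pos_semidef_diag_nonneg[OF \<open>pos_semidef A'\<close>, of k] d that
        by (auto simp: A'_nth divide_le_0_iff mult_le_0_iff)
      then have "{k. A' $ k $ k \<noteq> 0} \<subseteq> {k. A $ k $ k \<noteq> 0}" by blast
      moreover have "A' $ i $ i = 0" using d by (simp add: A'_nth flip: d_def)
      ultimately show "{k. A' $ k $ k \<noteq> 0} \<subset> {k. A $ k $ k \<noteq> 0}"
        using i by blast
    qed simp
    ultimately obtain ws where "A' = sum_list (map outer ws)"
      using less.hyps by blast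
    then have "A = sum_list (map outer (z # ws))" by (simp add: A'_def algebra_simps)
    then show ?thesis by blast
  qed
qed

text \<open>Decomposing \<open>A\<close> into rank-one terms turns the inner product into a sum of
  values of the form of \<open>B\<close>.\<close>

lemma pos_semidef_inner_nonneg:
  fixes A B :: "real ^ 'p ^ 'p"
  assumes "pos_semidef A" "pos_semidef B"
  shows "A \<bullet> B \<ge> 0"
proof -
  obtain ws where ws: "A = sum_list (map outer ws)"
    using pos_semidef_eq_sum_outer[OF assms(1)] by blast
  have "B \<bullet> sum_list (map outer ws) \<ge> 0" for ws
    using assms(2) by (induction ws) (auto simp: inner_add_right inner_outer pos_semidef_def)
  then show ?thesis by (simp add: ws inner_commute)
qed

lemma pos_def_add_pos_semidef:
  fixes K H :: "real ^ 'p ^ 'p"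
  assumes "pos_def K" "pos_semidef H"
  shows "pos_def (K + H)"
  using assms
  by (auto simp: pos_def_def pos_semidef_def transpose_eq_iff_nth matrix_vector_mult_add_rdistrib
      inner_add_right intro: add_pos_nonneg)

text \<open>The rank-one summands of \<open>H\<close> are added one at a time; each nonzero one
  strictly increases the determinant.\<close>

lemma det_add_pos_semidef_less:
  fixes K H :: "real ^ 'p ^ 'p"
  assumes "pos_def K" "pos_semidef H" "H \<noteq> 0"
  shows "det K < det (K + H)"
proof -
  obtain ws where ws: "H = sum_list (map outer ws)"
    using pos_semidef_eq_sum_outer[OF assms(2)] by blast
  have "pos_def K \<Longrightarrow> det K \<le> det (K + sum_list (map outer ws)) \<and>
      (sum_list (map outer ws) \<noteq> 0 \<longrightarrow> det K < det (K + sum_list (map outer ws)))" for ws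
  proof (induction ws arbitrary: K)
    case Nil
    then show ?case by simp
  next
    case (Cons z ws)
    show ?case
    proof (cases "z = 0")
      case True
      then have "outer z = 0" by (simp add: vec_eq_iff)
      then show ?thesis using Cons by simp
    next
      case False
      then have "det K < det (K + outer z)" by (rule det_add_outer_less[OF Cons.prems])
      with Cons.IH[OF pos_def_add_outer[OF Cons.prems], of z] show ?thesis
        by (auto simp: add.assoc)
    qed
  qed
  then show ?thesis using assms ws by blast
qed

lemma pos_semidef_outer: "pos_semidef (outer z)"
  by (auto simp: pos_semidef_def transpose_eq_iff_nth outer_mult_vec inner_commute)

lemma pos_semidef_add: "pos_semidef A \<Longrightarrow> pos_semidef B \<Longrightarrow> pos_semidef (A + B)"
  by (simp add: pos_semidef_def transpose_eq_iff_nth matrix_vector_mult_add_rdistrib inner_add_right)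

text \<open>Let \<open>c\<close> be the minimum of the form on the unit sphere. Then
  \<open>A - c *\<^sub>R mat 1\<close> is positive semidefinite, so its inner product with
  \<open>K\<close> is nonnegative; \<open>K\<close> paired with \<open>mat 1\<close> is the
  trace.\<close>

lemma pos_def_coercive:
  fixes A :: "real ^ 'p ^ 'p"
  assumes "pos_def A"
  obtains c where "c > 0" "\<And>K. pos_semidef K \<Longrightarrow> K \<bullet> A \<ge> c * (K \<bullet> mat 1)"
proof -
  let ?S = "sphere 0 1 :: (real ^ 'p) set"
  obtain i :: 'p where True by blast
  have "axis i 1 \<in> ?S" by simp
  then have "?S \<noteq> {}" by blast
  moreover have "continuous_on ?S (\<lambda>x. x \<bullet> (A *v x))"
    by (intro continuous_intros)
  ultimately obtain u where u: "u \<in> ?S" "\<And>x. x \<in> ?S \<Longrightarrow> u \<bullet> (A *v u) \<le> x \<bullet> (A *v x)"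
    using continuous_attains_inf[OF compact_sphere] by blast
  define c where "c = u \<bullet> (A *v u)"
  have "u \<noteq> 0" using u(1) by auto
  then have "c > 0" using assms by (simp add: c_def pos_def_def)
  moreover have "K \<bullet> A \<ge> c * (K \<bullet> mat 1)" if "pos_semidef K" for K
  proof -
    have "x \<bullet> (A *v x) \<ge> c * (x \<bullet> x)" for x
    proof (cases "x = 0")
      case False
      have "c \<le> (x /\<^sub>R norm x) \<bullet> (A *v (x /\<^sub>R norm x))"
        using False unfolding c_def by (intro u(2)) simp
      then show ?thesis
        using False by (simp add: matrix_vector_mult_scaleR field_simps
            power2_norm_eq_inner[symmetric] power2_eq_square)
    qed simp
    moreover have "transpose (A - c *\<^sub>R mat 1) = A - c *\<^sub>R mat 1"
      using assms by (simp add: pos_def_def transpose_eq_iff_nth mat_def)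
    ultimately have "pos_semidef (A - c *\<^sub>R mat 1)"
      by (simp add: pos_semidef_def matrix_vector_mult_diff_rdistrib inner_diff_right
          flip: scaleR_matrix_vector_assoc)
    from pos_semidef_inner_nonneg[OF that this] show ?thesis by (simp add: inner_diff_right)
  qed
  ultimately show thesis by (rule that)
qed

lemma pos_semidef_entry_le_trace:
  fixes K :: "real ^ 'p ^ 'p"
  assumes "pos_semidef K"
  shows "\<bar>K $ i $ j\<bar> \<le> K \<bullet> mat 1"
proof -
  have tr: "K \<bullet> mat 1 = (\<Sum>i\<in>UNIV. K $ i $ i)"
    by (simp add: inner_vec_def mat_def if_distrib cong: if_cong)
  have "K $ i $ i \<le> K \<bullet> mat 1" for i
    unfolding tr using pos_semidef_diag_nonneg[OF assms] by (intro member_le_sum) auto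
  from this[of i] this[of j] show ?thesis using pos_semidef_entry_bound[OF assms, of i j] by simp
qed

text \<open>The Leibniz formula has one term per permutation, each a product of entries bounded by
  \<open>B\<close>.\<close>

lemma abs_det_le:
  fixes A :: "real ^ 'p ^ 'p"
  assumes "\<And>i j. \<bar>A $ i $ j\<bar> \<le> B"
  shows "\<bar>det A\<bar> \<le> fact CARD('p) * B ^ CARD('p)"
proof -
  have "\<bar>det A\<bar> \<le> (\<Sum>p | p permutes (UNIV :: 'p set). \<bar>of_int (sign p) * (\<Prod>i\<in>UNIV. A $ i $ p i)\<bar>)"
    unfolding det_def by (rule sum_abs)
  also have "\<dots> \<le> (\<Sum>p | p permutes (UNIV :: 'p set). B ^ CARD('p))"
  proof (rule sum_mono)
    fix p
    have "\<bar>of_int (sign p) * (\<Prod>i\<in>UNIV. A $ i $ p i)\<bar> = (\<Prod>i\<in>UNIV. \<bar>A $ i $ p i\<bar>)"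
      by (simp add: abs_mult abs_prod sign_def)
    also have "\<dots> \<le> (\<Prod>i\<in>(UNIV::'p set). B)"
      using assms by (intro prod_mono) auto
    finally show "\<bar>of_int (sign p) * (\<Prod>i\<in>UNIV. A $ i $ p i)\<bar> \<le> B ^ CARD('p)" by simp
  qed
  also have "\<dots> = fact CARD('p) * B ^ CARD('p)"
    by (simp add: card_permutations)
  finally show ?thesis .
qed

section \<open>Existence of the maximum likelihood estimator\<close>

definition scatter :: "nat \<Rightarrow> (nat \<Rightarrow> real ^ 'p) \<Rightarrow> real ^ 'p ^ 'p" where
  "scatter n X = (\<Sum>k=1..n. outer (X k))"

definition has_pattern :: "('p \<times> 'p) set \<Rightarrow> real ^ 'p ^ 'p \<Rightarrow> bool" where
  "has_pattern E K \<longleftrightarrow> (\<forall>i j. (i, j) \<notin> E \<longrightarrow> K $ i $ j = 0)"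

text \<open>Up to a positive constant factor, this is the square of the likelihood at \<open>matrix_inv K\<close>.\<close>

definition precision_objective :: "nat \<Rightarrow> (nat \<Rightarrow> real ^ 'p) \<Rightarrow> real ^ 'p ^ 'p \<Rightarrow> real" where
  "precision_objective n X K = det K ^ n * exp (- (K \<bullet> scatter n X))"

section \<open>The likelihood as a function of the precision matrix\<close>

lemma scatter_nth: "scatter n X $ i $ j = (\<Sum>k=1..n. X k $ i * X k $ j)"
  by (simp add: scatter_def)

lemma inner_scatter:
  fixes K :: "real ^ 'p ^ 'p"
  shows "K \<bullet> scatter n X = (\<Sum>k=1..n. X k \<bullet> (K *v X k))"
  by (simp add: scatter_def inner_sum_right inner_outer)

text \<open>Keeping everything under one square root leaves only integral powers of the determinant
  once the observations are multiplied together.\<close>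

lemma mvn_density_matrix_inv:
  fixes K :: "real ^ 'p ^ 'p"
  assumes "pos_def K"
  shows "mvn_density (matrix_inv K) x =
    sqrt (det K * exp (- (x \<bullet> (K *v x))) / (2 * pi) ^ CARD('p))"
proof -
  have "det K * det (matrix_inv K) = 1"
    by (metis det_I det_mul matrix_inv_inverse(1) pos_def_invertible assms)
  then have d: "det (matrix_inv K) = 1 / det K"
    using pos_def_det_pos[OF assms] by (simp add: field_simps)
  have e: "exp (- (x \<bullet> (K *v x)) / 2) = sqrt (exp (- (x \<bullet> (K *v x))))"
    by (rule real_sqrt_unique[symmetric]) (simp_all flip: exp_double)
  show ?thesis
    unfolding mvn_density_def pos_def_matrix_inv(2)[OF assms] d e
    by (simp add: real_sqrt_divide real_sqrt_mult field_simps)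
qed

lemma likelihood_matrix_inv:
  fixes K :: "real ^ 'p ^ 'p"
  assumes "pos_def K"
  shows "likelihood n X (matrix_inv K) =
    sqrt (precision_objective n X K / ((2 * pi) ^ CARD('p)) ^ n)"
proof (induction n)
  case 0
  then show ?case by (simp add: likelihood_def precision_objective_def scatter_def)
next
  case (Suc n)
  have "likelihood (Suc n) X (matrix_inv K) =
      likelihood n X (matrix_inv K) * mvn_density (matrix_inv K) (X (Suc n))"
    by (simp add: likelihood_def)
  then show ?case
    unfolding Suc mvn_density_matrix_inv[OF assms] real_sqrt_mult[symmetric]
    by (simp add: precision_objective_def inner_scatter exp_add[symmetric] ac_simps
        flip: exp_minus)
qed

text \<open>Inversion turns the model into the positive definite matrices with a linear zero
  pattern, and the square root and the positive constant preserve the order of the objective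
  values.\<close>

lemma mle_exists_iff_precision:
  fixes X :: "nat \<Rightarrow> real ^ 'p"
  shows "mle_exists E n X \<longleftrightarrow>
    (\<exists>K. pos_def K \<and> has_pattern E K \<and>
      (\<forall>L. pos_def L \<and> has_pattern E L \<longrightarrow>
        precision_objective n X L \<le> precision_objective n X K))" (is "_ \<longleftrightarrow> ?R")
proof -
  have mem: "S \<in> gaussian_graphical_model E \<longleftrightarrow>
      (\<exists>K. pos_def K \<and> has_pattern E K \<and> S = matrix_inv K)" for S :: "real ^ 'p ^ 'p"
    unfolding gaussian_graphical_model_def has_pattern_def
    using pos_def_matrix_inv by (smt (verit, best) mem_Collect_eq)
  have le: "likelihood n X (matrix_inv L) \<le> likelihood n X (matrix_inv K) \<longleftrightarrow>
      precision_objective n X L \<le> precision_objective n X K"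
    if "pos_def K" "pos_def L" for K L
  proof -
    have "((2 * pi) ^ CARD('p)) ^ n > 0" by simp
    then show ?thesis
      unfolding likelihood_matrix_inv[OF that(1)] likelihood_matrix_inv[OF that(2)]
        real_sqrt_le_iff by (subst divide_le_cancel) (meson less_asym)
  qed
  show ?thesis
    unfolding mle_exists_def using mem le by (smt (verit, best))
qed

text \<open>Adding \<open>H\<close> keeps the exponential factor and strictly increases the
  determinant, so no \<open>K\<close> is optimal.\<close>

lemma not_mle_exists_if_recession:
  fixes H :: "real ^ 'p ^ 'p"
  assumes "n \<ge> 1" "pos_semidef H" "H \<noteq> 0" "has_pattern E H" "H \<bullet> scatter n X = 0"
  shows "\<not> mle_exists E n X"
proof -
  have "\<exists>L. pos_def L \<and> has_pattern E L \<and> precision_objective n X K < precision_objective n X L"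
    if K: "pos_def K" "has_pattern E K" for K
  proof (intro exI conjI)
    show "pos_def (K + H)" by (rule pos_def_add_pos_semidef) fact+
    show "has_pattern E (K + H)" using K(2) assms(4) by (simp add: has_pattern_def)
    have "det K ^ n < det (K + H) ^ n"
      using det_add_pos_semidef_less[OF K(1) assms(2,3)] pos_def_det_pos[OF K(1)] assms(1)
      by (intro power_strict_mono) auto
    then show "precision_objective n X K < precision_objective n X (K + H)"
      using assms(5) by (simp add: precision_objective_def inner_add_left)
  qed
  then show ?thesis unfolding mle_exists_iff_precision by (meson not_less)
qed

lemma compact_pos_semidef_trace_le:
  "compact {K :: real ^ 'p ^ 'p. pos_semidef K \<and> has_pattern E K \<and> K \<bullet> mat 1 \<le> R}"
    (is "compact ?C")
proof -
  have "closed ?C"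
    unfolding pos_semidef_def has_pattern_def transpose_eq_iff_nth inner_outer[symmetric]
    by (intro closed_Collect_conj closed_Collect_all closed_Collect_imp open_Collect_const
        closed_Collect_le closed_Collect_eq continuous_intros)
  moreover have "norm K \<le> (\<Sum>i\<in>(UNIV::'p set). \<Sum>j\<in>(UNIV::'p set). R)" if "K \<in> ?C" for K
  proof -
    have "norm K \<le> (\<Sum>i\<in>UNIV. norm (K $ i))"
      unfolding norm_vec_def[of K] by (rule L2_set_le_sum) simp
    also have "\<dots> \<le> (\<Sum>i\<in>UNIV. \<Sum>j\<in>UNIV. \<bar>K $ i $ j\<bar>)"
      by (intro sum_mono norm_le_l1_cart)
    also have "\<dots> \<le> (\<Sum>i\<in>(UNIV::'p set). \<Sum>j\<in>(UNIV::'p set). R)"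
      by (intro sum_mono order_trans[OF pos_semidef_entry_le_trace]) (use that in auto)
    finally show ?thesis .
  qed
  ultimately show ?thesis by (auto simp: compact_eq_bounded_closed bounded_iff)
qed

text \<open>The sufficiency half of Dempster's criterion, for the unnormalized scatter matrix. On
  matrices with the pattern, \<open>A\<close> may replace the scatter matrix, and coercivity of
  \<open>A\<close> confines the search to a compact set.\<close>

lemma mle_exists_if_completion:
  fixes A :: "real ^ 'p ^ 'p"
  assumes n: "n \<ge> 1" and A: "pos_def A"
    and loops: "\<And>i. (i, i) \<in> E"
    and eq: "\<And>i j. (i, j) \<in> E \<Longrightarrow> A $ i $ j = scatter n X $ i $ j"
  shows "mle_exists E n X"
proof -
  have obj: "precision_objective n X K = det K ^ n * exp (- (K \<bullet> A))" if "has_pattern E K" for K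
  proof -
    have "K \<bullet> scatter n X = K \<bullet> A"
      unfolding inner_vec_def inner_real_def
      using eq that by (intro sum.cong refl) (metis has_pattern_def mult_zero_left)
    then show ?thesis by (simp add: precision_objective_def)
  qed
  obtain c where c: "c > 0" "\<And>K. pos_semidef K \<Longrightarrow> K \<bullet> A \<ge> c * (K \<bullet> mat 1)"
    using pos_def_coercive[OF A] by blast
  \<comment> \<open>The bound on the determinant by a power of the trace, times the exponential
    decay in the trace.\<close>
  define g :: "real \<Rightarrow> real" where
    "g t = fact CARD('p) ^ n * t ^ (CARD('p) * n) * exp (- (c * t))" for t
  have bound: "precision_objective n X K \<le> g (K \<bullet> mat 1)"
    if K: "pos_semidef K" "has_pattern E K" for K
  proof -
    have "det K ^ n \<le> \<bar>det K\<bar> ^ n" by (metis abs_ge_self power_abs)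
    also have "\<dots> \<le> (fact CARD('p) * (K \<bullet> mat 1) ^ CARD('p)) ^ n"
      using abs_det_le[of K] pos_semidef_entry_le_trace[OF K(1)] by (intro power_mono) auto
    finally have "det K ^ n \<le> (fact CARD('p) * (K \<bullet> mat 1) ^ CARD('p)) ^ n" .
    moreover have "0 \<le> K \<bullet> mat 1"
      using pos_semidef_entry_le_trace[OF K(1)] abs_ge_zero order_trans by blast
    ultimately show ?thesis
      unfolding obj[OF K(2)] g_def power_mult power_mult_distrib[symmetric]
      using c(2)[OF K(1)] by (intro mult_mono) auto
  qed
  have "(g \<longlongrightarrow> 0) at_top"
    unfolding g_def using c(1) by real_asymp
  moreover have id: "has_pattern E (mat 1)" "pos_def (mat 1 :: real ^ 'p ^ 'p)"
    using loops pos_def_mat_1 by (auto simp: has_pattern_def mat_def)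
  then have pos: "precision_objective n X (mat 1) > 0"
    by (simp add: obj)
  ultimately have "eventually (\<lambda>t. g t < precision_objective n X (mat 1)) at_top"
    using order_tendstoD(2) by blast
  then obtain R where R: "\<And>t. t \<ge> R \<Longrightarrow> g t < precision_objective n X (mat 1)"
    unfolding eventually_at_top_linorder by blast
  define C where "C = {K :: real ^ 'p ^ 'p. pos_semidef K \<and> has_pattern E K \<and>
      K \<bullet> mat 1 \<le> max R (mat 1 \<bullet> (mat 1 :: real ^ 'p ^ 'p))}"
  have "compact C" unfolding C_def by (rule compact_pos_semidef_trace_le)
  moreover have "mat 1 \<in> C"
    using id by (simp add: C_def pos_def_imp_pos_semidef)
  moreover have "continuous_on C (precision_objective n X)"
    unfolding precision_objective_def by (intro continuous_intros)
  ultimately obtain K where K: "K \<in> C"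
      "\<And>L. L \<in> C \<Longrightarrow> precision_objective n X L \<le> precision_objective n X K"
    using continuous_attains_sup[of C] by (metis empty_iff)
  have K1: "precision_objective n X (mat 1) \<le> precision_objective n X K"
    using K(2) \<open>mat 1 \<in> C\<close> by blast
  \<comment> \<open>The maximizer is not on the singular boundary: there the objective is zero,
    since \<open>n\<close> is positive.\<close>
  then have "det K \<noteq> 0"
    using pos n by (auto simp: precision_objective_def power_0_left)
  then have "pos_def K"
    using K(1) pos_semidef_invertible_imp_pos_def unfolding C_def by blast
  moreover have "precision_objective n X L \<le> precision_objective n X K"
    if L: "pos_def L" "has_pattern E L" for L
  proof (cases "L \<in> C")
    case False
    then have "L \<bullet> mat 1 \<ge> R"
      using L pos_def_imp_pos_semidef by (auto simp: C_def)
    then show ?thesis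
      using R bound[OF pos_def_imp_pos_semidef[OF L(1)] L(2)] K1 by (meson less_imp_le order_trans)
  qed (use K in blast)
  moreover have "has_pattern E K" using K(1) by (simp add: C_def)
  ultimately show ?thesis unfolding mle_exists_iff_precision by blast
qed

section \<open>Complete bipartite graphs with a part of size two\<close>

lemma complete_bipartite_iff:
  "(i, j) \<in> complete_bipartite {a, b} (- {a, b}) \<longleftrightarrow> i = j \<or> (i \<in> {a, b} \<longleftrightarrow> j \<notin> {a, b})"
  unfolding complete_bipartite_def by blast

text \<open>
  The number \<open>r\<close> is the value of the completed matrix at the missing edge \<open>(a, b)\<close>; adding this
  edge makes the graph chordal with cliques \<open>{a, b, j}\<close>.  In the proof, \<open>P\<close> and \<open>Q\<close> are the first
  two Cholesky columns, and \<open>d j\<close> is the last pivot of the clique \<open>{a, b, j}\<close>.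
\<close>

lemma complete_bipartite_completion:
  fixes G :: "real ^ 'p ^ 'p"
  assumes ab: "a \<noteq> b" and sym: "\<And>i j. G $ i $ j = G $ j $ i"
    and ne: "- {a, b} \<noteq> {}"
    and pd: "\<And>j \<alpha> \<beta> \<gamma>. j \<notin> {a, b} \<Longrightarrow> (\<alpha>, \<beta>, \<gamma>) \<noteq> (0, 0, 0) \<Longrightarrow>
      \<alpha>\<^sup>2 * G $ a $ a + \<beta>\<^sup>2 * G $ b $ b + \<gamma>\<^sup>2 * G $ j $ j + 2 * \<alpha> * \<beta> * r
        + 2 * \<alpha> * \<gamma> * G $ a $ j + 2 * \<beta> * \<gamma> * G $ b $ j > 0"
  obtains A where "pos_def A"
    "\<And>i j. (i, j) \<in> complete_bipartite {a, b} (- {a, b}) \<Longrightarrow> A $ i $ j = G $ i $ j"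
proof -
  obtain j0 where j0: "j0 \<notin> {a, b}" using ne by blast
  have Ga: "G $ a $ a > 0" using pd[OF j0, of 1 0 0] by simp
  define g where "g = sqrt (G $ a $ a)"
  have g: "g > 0" "g * g = G $ a $ a" using Ga by (simp_all add: g_def)
  \<comment> \<open>Minimizing the form on \<open>{a, b}\<close> over the first coefficient leaves
    the Schur complement.\<close>
  have "0 < (- (r / G $ a $ a))\<^sup>2 * G $ a $ a + G $ b $ b + 2 * (- (r / G $ a $ a)) * r"
    using pd[OF j0, of "- (r / G $ a $ a)" 1 0] by simp
  then have "G $ b $ b - r\<^sup>2 / G $ a $ a > 0"
    using Ga by (simp add: power2_eq_square field_simps)
  moreover define h where "h = sqrt (G $ b $ b - r\<^sup>2 / G $ a $ a)"
  ultimately have h: "h > 0" "h * h = G $ b $ b - r\<^sup>2 / G $ a $ a" by simp_all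
  define P :: "real ^ 'p" where
    "P = (\<chi> i. if i = a then g else if i = b then r / g else G $ a $ i / g)"
  define Q :: "real ^ 'p" where
    "Q = (\<chi> i. if i = a then 0 else if i = b then h else (G $ b $ i - P $ b * P $ i) / h)"
  define d where "d i = (if i \<in> {a, b} then 0 else G $ i $ i - (P $ i)\<^sup>2 - (Q $ i)\<^sup>2)" for i
  \<comment> \<open>Only diagonal entries outside \<open>{a, b}\<close> are corrected by
    \<open>d\<close>; the unprescribed entries between two vertices outside \<open>{a, b}\<close>
    are whatever \<open>P\<close> and \<open>Q\<close> produce.\<close>
  define A :: "real ^ 'p ^ 'p" where
    "A = outer P + outer Q + (\<chi> i j. if i = j then d i else 0)"
  have Pa: "P $ a = g" and Pb: "P $ b = r / g" and Qa: "Q $ a = 0" and Qb: "Q $ b = h"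
    using ab by (auto simp: P_def Q_def)
  have Pj: "g * P $ j = G $ a $ j" and Qj: "h * Q $ j = G $ b $ j - P $ b * P $ j"
    if "j \<notin> {a, b}" for j
    using that g h by (auto simp: P_def Q_def)
  have bb: "P $ b * P $ b + h * h = G $ b $ b"
    using g h by (simp add: Pb power2_eq_square)
  have gPb: "g * P $ b = r" using g by (simp add: Pb)
  have dpos: "d j > 0" if j: "j \<notin> {a, b}" for j
  proof -
    \<comment> \<open>Back substitution: with third coefficient 1, these values make both squares
      vanish and leave only \<open>d j\<close>.\<close>
    define \<beta> where "\<beta> = - Q $ j / h"
    define \<alpha> where "\<alpha> = - (P $ j + \<beta> * P $ b) / g"
    have z: "\<beta> * h + Q $ j = 0" "\<alpha> * g + \<beta> * P $ b + P $ j = 0"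
      using g h by (simp_all add: \<beta>_def \<alpha>_def)
    have "0 < \<alpha>\<^sup>2 * (g * g) + \<beta>\<^sup>2 * (P $ b * P $ b + h * h) + G $ j $ j + 2 * \<alpha> * \<beta> * (g * P $ b)
        + 2 * \<alpha> * (g * P $ j) + 2 * \<beta> * (h * Q $ j + P $ b * P $ j)"
      using pd[OF j, of \<alpha> \<beta> 1] Pj[OF j] Qj[OF j] by (simp add: g bb gPb)
    also have "\<dots> = (\<alpha> * g + \<beta> * P $ b + P $ j)\<^sup>2 + (\<beta> * h + Q $ j)\<^sup>2 + d j"
      using j by (simp add: d_def power2_eq_square algebra_simps)
    finally show ?thesis using z by simp
  qed
  have "x \<bullet> (A *v x) > 0" if x: "x \<noteq> 0" for x
  proof -
    have "(\<chi> i j. if i = j then d i else 0) *v x = (\<chi> i. d i * x $ i)"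
      by (simp add: vec_eq_iff matrix_vector_mult_def if_distrib if_distribR cong: if_cong)
    then have eq: "x \<bullet> (A *v x) = (P \<bullet> x)\<^sup>2 + (Q \<bullet> x)\<^sup>2 + (\<Sum>i\<in>UNIV. d i * (x $ i)\<^sup>2)"
      by (simp add: A_def matrix_vector_mult_add_rdistrib inner_add_right outer_mult_vec
          inner_commute power2_eq_square inner_vec_def[of x "vec_lambda _"] ac_simps)
    have dx: "d i * (x $ i)\<^sup>2 \<ge> 0" for i
      using dpos[of i] by (cases "i \<in> {a, b}") (auto simp: d_def[of i])
    then have "(\<Sum>i\<in>UNIV. d i * (x $ i)\<^sup>2) \<ge> 0" by (intro sum_nonneg)
    \<comment> \<open>Positivity of \<open>d\<close> clears the coordinates outside
      \<open>{a, b}\<close>; since \<open>Q $ a = 0\<close>, the vector \<open>Q\<close> then clears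
      \<open>b\<close> and \<open>P\<close> clears \<open>a\<close>.\<close>
    moreover have "\<not> (P \<bullet> x = 0 \<and> Q \<bullet> x = 0 \<and> (\<Sum>i\<in>UNIV. d i * (x $ i)\<^sup>2) = 0)"
    proof
      assume zero: "P \<bullet> x = 0 \<and> Q \<bullet> x = 0 \<and> (\<Sum>i\<in>UNIV. d i * (x $ i)\<^sup>2) = 0"
      then have "d i * (x $ i)\<^sup>2 = 0" for i
        using dx sum_nonneg_eq_0_iff[of UNIV "\<lambda>i. d i * (x $ i)\<^sup>2"] by simp
      then have xj: "x $ j = 0" if "j \<notin> {a, b}" for j
        using dpos[OF that] by (metis mult_eq_0_iff less_irrefl zero_eq_power2)
      have two: "y \<bullet> x = y $ a * x $ a + y $ b * x $ b" for y :: "real ^ 'p"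
      proof -
        have "y \<bullet> x = (\<Sum>i\<in>{a, b}. y $ i * x $ i)"
          unfolding inner_vec_def inner_real_def
          using xj by (intro sum.mono_neutral_right) auto
        then show ?thesis using ab by simp
      qed
      have "x $ b = 0" using zero h(1) by (simp add: two Qa Qb)
      moreover have "x $ a = 0" using zero g(1) \<open>x $ b = 0\<close> by (simp add: two Pa)
      ultimately have "x $ i = 0" for i using xj by (cases "i \<in> {a, b}") auto
      then have "x = 0" by (simp add: vec_eq_iff)
      then show False using x by blast
    qed
    ultimately show ?thesis unfolding eq
      by (smt (verit) zero_le_power2 zero_eq_power2)
  qed
  moreover have "transpose A = A" by (simp add: transpose_eq_iff_nth A_def)
  ultimately have "pos_def A" by (simp add: pos_def_def)
  moreover have "A $ i $ j = G $ i $ j" if ij: "(i, j) \<in> complete_bipartite {a, b} (- {a, b})" for i j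
  proof -
    have aj: "A $ a $ j = G $ a $ j" "A $ b $ j = G $ b $ j" if "j \<notin> {a, b}" for j
      using Pj[OF that] Qj[OF that] that by (auto simp: A_def Pa Qa Qb)
    have symA: "A $ i $ j = A $ j $ i" for i j by (simp add: A_def)
    have "A $ i $ i = G $ i $ i"
    proof (cases "i \<in> {a, b}")
      case True
      then show ?thesis using bb g ab by (auto simp: A_def d_def Pa Qa Qb)
    next
      case False
      then show ?thesis by (simp add: A_def d_def power2_eq_square)
    qed
    then show ?thesis using ij aj symA sym unfolding complete_bipartite_iff
      by (metis insert_iff singletonD)
  qed
  ultimately show thesis by (rule that)
qed

text \<open>Here \<open>r\<close> is the shift away from the Gram value at the missing edge, so the
  Gram part of each clique form is a sum of squares.\<close>

lemma mle_exists_complete_bipartite: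
  fixes X :: "nat \<Rightarrow> real ^ 'p"
  assumes "n \<ge> 1" "a \<noteq> b" "- {a, b} \<noteq> {}"
    and "\<And>j \<alpha> \<beta> \<gamma>. j \<notin> {a, b} \<Longrightarrow> (\<alpha>, \<beta>, \<gamma>) \<noteq> (0, 0, 0) \<Longrightarrow>
      (\<Sum>k=1..n. (\<alpha> * X k $ a + \<beta> * X k $ b + \<gamma> * X k $ j)\<^sup>2) + 2 * \<alpha> * \<beta> * r > 0"
  shows "mle_exists (complete_bipartite {a, b} (- {a, b})) n X"
proof -
  let ?G = "scatter n X"
  let ?r = "?G $ a $ b + r"
  have "\<alpha>\<^sup>2 * ?G $ a $ a + \<beta>\<^sup>2 * ?G $ b $ b + \<gamma>\<^sup>2 * ?G $ j $ j + 2 * \<alpha> * \<beta> * ?r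
        + 2 * \<alpha> * \<gamma> * ?G $ a $ j + 2 * \<beta> * \<gamma> * ?G $ b $ j > 0"
    if "j \<notin> {a, b}" "(\<alpha>, \<beta>, \<gamma>) \<noteq> (0, 0, 0)" for j \<alpha> \<beta> \<gamma>
  proof -
    have "\<alpha>\<^sup>2 * ?G $ a $ a + \<beta>\<^sup>2 * ?G $ b $ b + \<gamma>\<^sup>2 * ?G $ j $ j + 2 * \<alpha> * \<beta> * ?G $ a $ b
        + 2 * \<alpha> * \<gamma> * ?G $ a $ j + 2 * \<beta> * \<gamma> * ?G $ b $ j =
        (\<Sum>k=1..n. (\<alpha> * X k $ a + \<beta> * X k $ b + \<gamma> * X k $ j)\<^sup>2)"
      unfolding scatter_nth sum_distrib_left sum.distrib[symmetric]
      by (intro sum.cong refl) (simp add: power2_eq_square algebra_simps)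
    then show ?thesis using assms(4)[OF that] by (simp add: algebra_simps)
  qed
  from complete_bipartite_completion[OF assms(2) _ assms(3) this]
  obtain A where A: "pos_def A"
    "\<And>i j. (i, j) \<in> complete_bipartite {a, b} (- {a, b}) \<Longrightarrow> A $ i $ j = ?G $ i $ j"
    by (auto simp: scatter_nth mult.commute)
  show ?thesis
    by (rule mle_exists_if_completion[OF assms(1) A(1) _ A(2)])
      (simp_all add: complete_bipartite_iff)
qed

lemma outer_inner_scatter:
  "outer z \<bullet> scatter n X = (\<Sum>k=1..n. (z \<bullet> X k)\<^sup>2)"
  by (simp add: inner_scatter outer_mult_vec power2_eq_square inner_commute)

text \<open>A linear relation between data rows \<open>i\<close> and \<open>j\<close> is a vector
  supported on one edge and orthogonal to every observation; its outer product is a recession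
  direction.\<close>

lemma not_mle_exists_if_proportional:
  fixes X :: "nat \<Rightarrow> real ^ 'p"
  assumes n: "n \<ge> 1" and ij: "i \<in> {a, b}" "j \<notin> {a, b}"
    and st: "(s, t) \<noteq> (0, 0)" and zero: "\<And>k. k \<in> {1..n} \<Longrightarrow> s * X k $ i + t * X k $ j = 0"
  shows "\<not> mle_exists (complete_bipartite {a, b} (- {a, b})) n X"
proof (rule not_mle_exists_if_recession[OF n pos_semidef_outer])
  define z where "z = axis i s + axis j t"
  have "i \<noteq> j" using ij by blast
  then have z: "z $ i = s" "z $ j = t" "\<And>k. k \<notin> {i, j} \<Longrightarrow> z $ k = 0"
    by (auto simp: z_def axis_def)
  show "outer z \<noteq> 0"
    using st z(1,2) by (metis mult_eq_0_iff outer_nth prod.inject zero_index)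
  show "has_pattern (complete_bipartite {a, b} (- {a, b})) (outer z)"
    unfolding has_pattern_def complete_bipartite_iff
    using ij z(3) by (metis insert_iff mult_eq_0_iff outer_nth singletonD)
  have "z \<bullet> X k = s * X k $ i + t * X k $ j" for k
    by (simp add: z_def inner_add_left inner_axis')
  then show "outer z \<bullet> scatter n X = 0"
    using zero by (simp add: outer_inner_scatter)
qed

lemma outer_scaleR: "outer (c *\<^sub>R z) = c\<^sup>2 *\<^sub>R outer z"
  by (simp add: vec_eq_iff power2_eq_square ac_simps)

section \<open>Two observations and the signs of planar determinants\<close>

definition minor :: "(nat \<Rightarrow> real ^ 'p) \<Rightarrow> 'p \<Rightarrow> 'p \<Rightarrow> real" where
  "minor X i j = X 1 $ i * X 2 $ j - X 1 $ j * X 2 $ i"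

lemma sum_1_2: "(\<Sum>k=Suc 0..2. f k) = f 1 + (f 2 :: real)" for f :: "nat \<Rightarrow> real"
  by (simp add: numeral_2_eq_2)

text \<open>The discriminant of the perturbed form is negative exactly for \<open>e\<close> in this
  range. Concretely, the perturbation helps when \<open>s * \<alpha> * \<beta>\<close> is negative,
  and otherwise it is smaller than the gap between the squares of the sum and of the
  difference.\<close>

lemma perturbed_square_pos:
  fixes p q e \<alpha> \<beta> :: real
  assumes e: "0 < e" "e < 2 * (s * p * q)" and s: "s\<^sup>2 = 1" and nz: "(\<alpha>, \<beta>) \<noteq> (0, 0)"
  shows "(\<alpha> * p + \<beta> * q)\<^sup>2 - 2 * e * s * \<alpha> * \<beta> > 0"
proof -
  have "p \<noteq> 0" "q \<noteq> 0" using e by auto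
  have s: "s = 1 \<or> s = -1" using s by (simp add: power2_eq_1_iff)
  show ?thesis
  proof (cases "s * \<alpha> * \<beta> > 0")
    case True
    have "0 \<le> (\<alpha> * p - \<beta> * q)\<^sup>2" by simp
    also have "\<dots> = (\<alpha> * p + \<beta> * q)\<^sup>2 - 4 * (s * p * q) * (s * \<alpha> * \<beta>)"
      using s by (auto simp: power2_eq_square algebra_simps)
    also have "\<dots> < (\<alpha> * p + \<beta> * q)\<^sup>2 - 2 * e * (s * \<alpha> * \<beta>)"
      using mult_strict_right_mono[OF e(2) True] by linarith
    finally show ?thesis by (simp add: ac_simps)
  next
    case np: False
    show ?thesis
    proof (cases "s * \<alpha> * \<beta> = 0")
      case True
      then have "\<alpha> = 0 \<or> \<beta> = 0" using s by auto
      then show ?thesis using nz \<open>p \<noteq> 0\<close> \<open>q \<noteq> 0\<close> by auto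
    next
      case False
      with np have "s * \<alpha> * \<beta> < 0" by (metis linorder_neqE_linordered_idom)
      then have "2 * e * (s * \<alpha> * \<beta>) < 0" using e(1) by (simp add: mult_less_0_iff)
      moreover have "(\<alpha> * p + \<beta> * q)\<^sup>2 \<ge> 0" by simp
      ultimately show ?thesis by linarith
    qed
  qed
qed

text \<open>
  At \<open>r = 0\<close> the forms on the cliques are singular.  The derivative in \<open>r\<close> of the determinant on
  \<open>{a, b, j}\<close> is \<open>- 2 * minor X a j * minor X b j\<close>, so if these all have the same sign, one small
  shift makes all the forms definite at once.
\<close>

lemma mle_exists_2_if_same_sign:
  fixes X :: "nat \<Rightarrow> real ^ 'p"
  assumes ab: "a \<noteq> b" and ne: "- {a, b} \<noteq> {}" and s: "s\<^sup>2 = 1"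
    and sign: "\<And>j. j \<notin> {a, b} \<Longrightarrow> s * minor X a j * minor X b j > 0"
  shows "mle_exists (complete_bipartite {a, b} (- {a, b})) 2 X"
proof -
  define N where "N j = (X 1 $ j)\<^sup>2 + (X 2 $ j)\<^sup>2" for j
  have N: "N j > 0" if "j \<notin> {a, b}" for j
  proof -
    have "minor X a j \<noteq> 0" using sign[OF that] by auto
    then have "X 1 $ j \<noteq> 0 \<or> X 2 $ j \<noteq> 0" by (auto simp: minor_def)
    then show ?thesis by (auto simp: N_def add_pos_nonneg add_nonneg_pos)
  qed
  define \<epsilon> where "\<epsilon> = Min ((\<lambda>j. s * minor X a j * minor X b j / N j) ` (- {a, b}))"
  have \<epsilon>0: "\<epsilon> > 0" unfolding \<epsilon>_def using ne sign N by (subst Min_gr_iff) auto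
  have \<epsilon>: "\<epsilon> * N j < 2 * (s * minor X a j * minor X b j)" if j: "j \<notin> {a, b}" for j
  proof -
    have "\<epsilon> \<le> s * minor X a j * minor X b j / N j"
      unfolding \<epsilon>_def using j by (intro Min_le) auto
    then show ?thesis using N[OF j] sign[OF j] by (simp add: field_simps)
  qed
  show ?thesis
  proof (rule mle_exists_complete_bipartite[OF _ ab ne, where r = "- (s * \<epsilon>)"])
    fix j \<alpha> \<beta> \<gamma>
    assume j: "j \<notin> {a, b}" and nz: "(\<alpha>, \<beta>, \<gamma>) \<noteq> (0 :: real, 0 :: real, 0 :: real)"
    define y where "y k = \<alpha> * X k $ a + \<beta> * X k $ b + \<gamma> * X k $ j" for k :: nat
    let ?F = "(y 1)\<^sup>2 + (y 2)\<^sup>2 + 2 * \<alpha> * \<beta> * - (s * \<epsilon>)"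
    have "?F > 0"
    proof (cases "(\<alpha>, \<beta>) = (0, 0)")
      case True
      then have "?F = \<gamma>\<^sup>2 * N j" by (simp add: y_def N_def power2_eq_square algebra_simps)
      then show ?thesis using True nz N[OF j] by simp
    next
      case False
      have "0 < (\<alpha> * minor X a j + \<beta> * minor X b j)\<^sup>2 - 2 * (\<epsilon> * N j) * s * \<alpha> * \<beta>"
        using perturbed_square_pos[OF _ \<epsilon>[OF j] s False] \<epsilon>0 N[OF j] by simp
      also have "\<dots> \<le> (\<alpha> * minor X a j + \<beta> * minor X b j)\<^sup>2 - 2 * (\<epsilon> * N j) * s * \<alpha> * \<beta>
          + (y 1 * X 1 $ j + y 2 * X 2 $ j)\<^sup>2" by simp
      also have "\<dots> = N j * ?F"
        by (simp add: y_def N_def minor_def power2_eq_square algebra_simps)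
      finally show ?thesis using N[OF j] by (simp add: zero_less_mult_iff)
    qed
    then show "(\<Sum>k=1..2. (\<alpha> * X k $ a + \<beta> * X k $ b + \<gamma> * X k $ j)\<^sup>2)
        + 2 * \<alpha> * \<beta> * - (s * \<epsilon>) > 0"
      by (simp add: sum_1_2 y_def)
  qed simp
qed

lemma not_mle_exists_2_if_opposite_sign:
  fixes X :: "nat \<Rightarrow> real ^ 'p"
  assumes ab: "a \<noteq> b" and j: "j \<notin> {a, b}" and k: "k \<notin> {a, b}"
    and pos: "minor X a j * minor X b j > 0" and neg: "minor X a k * minor X b k < 0"
  shows "\<not> mle_exists (complete_bipartite {a, b} (- {a, b})) 2 X"
proof -
  have jk: "j \<noteq> k" using pos neg by auto
  \<comment> \<open>the linear relation between the three planar vectors with indices \<open>a\<close>, \<open>b\<close>, \<open>l\<close>\<close>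
  define z where "z l = axis a (minor X b l) + axis b (- minor X a l) + axis l (minor X a b)" for l
  have z_nth: "z l $ a = minor X b l" "z l $ b = - minor X a l" "\<And>i. i \<notin> {a, b, l} \<Longrightarrow> z l $ i = 0"
    if "l \<notin> {a, b}" for l
    using that ab by (auto simp: z_def axis_def)
  have orth: "z l \<bullet> X i = 0" if "i \<in> {1, 2}" for l i
    using that by (auto simp: z_def inner_add_left inner_axis' minor_def algebra_simps)
  \<comment> \<open>weights that cancel the entry of \<open>H\<close> at the missing edge \<open>(a, b)\<close>\<close>
  define \<alpha> where "\<alpha> = - (minor X a k * minor X b k)"
  define \<beta> where "\<beta> = minor X a j * minor X b j"
  have \<alpha>\<beta>: "\<alpha> > 0" "\<beta> > 0" using pos neg by (simp_all add: \<alpha>_def \<beta>_def)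
  define H where "H = outer (sqrt \<alpha> *\<^sub>R z j) + outer (sqrt \<beta> *\<^sub>R z k)"
  have H_nth: "H $ i $ l = \<alpha> * (z j $ i * z j $ l) + \<beta> * (z k $ i * z k $ l)" for i l
    using \<alpha>\<beta> by (simp add: H_def outer_scaleR)
  show ?thesis
  proof (rule not_mle_exists_if_recession[of _ H])
    show "pos_semidef H" unfolding H_def by (intro pos_semidef_add pos_semidef_outer)
    have "z j $ a * z j $ a > 0" using pos z_nth(1)[OF j] by (auto simp: zero_less_mult_iff)
    then have "H $ a $ a > 0"
      unfolding H_nth using \<alpha>\<beta> by (intro add_pos_nonneg mult_pos_pos[of \<alpha>]) simp_all
    then show "H \<noteq> 0" by auto
    show "H \<bullet> scatter 2 X = 0"
      by (simp add: H_def inner_add_left outer_inner_scatter sum_1_2 orth)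
    show "has_pattern (complete_bipartite {a, b} (- {a, b})) H"
      unfolding has_pattern_def complete_bipartite_iff
    proof (intro allI impI)
      fix i l assume il: "\<not> (i = l \<or> (i \<in> {a, b} \<longleftrightarrow> l \<notin> {a, b}))"
      show "H $ i $ l = 0"
      proof (cases "i \<in> {a, b}")
        case True
        have "H $ a $ b = 0" "H $ b $ a = 0"
          by (simp_all add: H_nth z_nth(1,2)[OF j] z_nth(1,2)[OF k] \<alpha>_def \<beta>_def)
        then show ?thesis using il True by auto
      next
        case False
        then have "l \<notin> {a, b}" "i \<noteq> l" using il by auto
        then have "z m $ i * z m $ l = 0" if "m \<notin> {a, b}" for m
          using z_nth(3)[OF that, of i] z_nth(3)[OF that, of l] False by (cases "i = m") auto
        from this[OF j] this[OF k] show ?thesis by (simp only: H_nth mult_zero_right add_0)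
      qed
    qed
  qed simp
qed

lemma mle_exists_2_iff_minor:
  fixes X :: "nat \<Rightarrow> real ^ 'p"
  assumes ab: "a \<noteq> b" and ne: "- {a, b} \<noteq> {}"
  shows "mle_exists (complete_bipartite {a, b} (- {a, b})) 2 X \<longleftrightarrow>
    (\<forall>j\<in>- {a, b}. minor X a j * minor X b j > 0) \<or> (\<forall>j\<in>- {a, b}. minor X a j * minor X b j < 0)"
    (is "_ \<longleftrightarrow> ?same")
proof
  assume ?same
  then show "mle_exists (complete_bipartite {a, b} (- {a, b})) 2 X"
    using mle_exists_2_if_same_sign[OF ab ne, of 1 X] mle_exists_2_if_same_sign[OF ab ne, of "-1" X]
    by auto
next
  assume ex: "mle_exists (complete_bipartite {a, b} (- {a, b})) 2 X"
  have "minor X i j \<noteq> 0" if ij: "i \<in> {a, b}" "j \<notin> {a, b}" for i j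
  proof
    assume zero: "minor X i j = 0"
    have "\<exists>s t. (s, t) \<noteq> (0, 0) \<and> s * X 1 $ i + t * X 1 $ j = 0 \<and> s * X 2 $ i + t * X 2 $ j = 0"
    proof (cases "X 1 $ i = 0 \<and> X 1 $ j = 0")
      case False
      then show ?thesis
        using zero by (intro exI[of _ "X 1 $ j"] exI[of _ "- X 1 $ i"])
          (auto simp: minor_def algebra_simps)
    next
      case True
      show ?thesis
      proof (cases "X 2 $ i = 0 \<and> X 2 $ j = 0")
        case False
        then show ?thesis
          using True by (intro exI[of _ "X 2 $ j"] exI[of _ "- X 2 $ i"]) auto
      qed (use True in \<open>auto intro!: exI[of _ 1]\<close>)
    qed
    then obtain s t where "(s, t) \<noteq> (0, 0)" "s * X 1 $ i + t * X 1 $ j = 0"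
        "s * X 2 $ i + t * X 2 $ j = 0" by blast
    moreover have "k = 1 \<or> k = 2" if "k \<in> {1..2}" for k :: nat using that by auto
    ultimately show False
      using not_mle_exists_if_proportional[of 2 i a b j s t X] ij ex by fastforce
  qed
  then have "minor X a j * minor X b j \<noteq> 0" if "j \<notin> {a, b}" for j using that by simp
  then show ?same
    using not_mle_exists_2_if_opposite_sign[OF ab, of _ _ X] ex
    by (metis Compl_iff linorder_neqE_linordered_idom)
qed

lemma not_mle_exists_1:
  fixes X :: "nat \<Rightarrow> real ^ 'p"
  assumes ne: "- {a, b} \<noteq> {}"
  shows "\<not> mle_exists (complete_bipartite {a, b} (- {a, b})) 1 X"
proof -
  obtain j where j: "j \<notin> {a, b}" using ne by blast
  have "\<exists>s t. (s, t) \<noteq> (0, 0) \<and> s * X 1 $ a + t * X 1 $ j = 0"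
  proof (cases "X 1 $ a = 0")
    case True
    then show ?thesis by (intro exI[of _ 1] exI[of _ 0]) simp
  next
    case False
    then show ?thesis by (intro exI[of _ "X 1 $ j"] exI[of _ "- X 1 $ a"]) simp
  qed
  then obtain s t where "(s, t) \<noteq> (0, 0)" "s * X 1 $ a + t * X 1 $ j = 0" by blast
  then show ?thesis
    using not_mle_exists_if_proportional[of 1 a a b j s t X] j by simp
qed

section \<open>Direct neighbors\<close>

definition det2 :: "real ^ 2 \<Rightarrow> real ^ 2 \<Rightarrow> real" where
  "det2 u w = u $ 1 * w $ 2 - w $ 1 * u $ 2"

lemma det2_eq_inner: "det2 u w = vector [- u $ 2, u $ 1] \<bullet> w"
  by (simp add: det2_def inner_vec_def sum_2)

lemma det2_scaleR_right: "det2 u (c *\<^sub>R w) = c * det2 u w"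
  by (simp add: det2_eq_inner)

lemma det2_minus_right: "det2 u (- w) = - det2 u w"
  by (simp add: det2_eq_inner)

lemma is_line_span_iff: "is_line (span {u}) \<longleftrightarrow> u \<noteq> 0"
  by (simp add: is_line_def)

lemma mem_span_iff_det2:
  assumes "p \<noteq> 0"
  shows "u \<in> span {p} \<longleftrightarrow> det2 p u = 0"
proof
  assume "u \<in> span {p}"
  then show "det2 p u = 0" by (auto simp: span_singleton det2_def)
next
  assume d: "det2 p u = 0"
  have "\<exists>k. u = k *\<^sub>R p"
  proof (cases "p $ 1 = 0")
    case True
    then have "p $ 2 \<noteq> 0" using assms by (auto simp: vec_eq_iff forall_2)
    then show ?thesis
      using d True by (intro exI[of _ "u $ 2 / p $ 2"]) (auto simp: vec_eq_iff forall_2 det2_def)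
  next
    case False
    then show ?thesis
      using d by (intro exI[of _ "u $ 1 / p $ 1"])
        (auto simp: vec_eq_iff forall_2 det2_def field_simps)
  qed
  then show "u \<in> span {p}" by (auto simp: span_singleton)
qed

lemma connected_component_complement_lines:
  assumes pq: "p \<noteq> 0" "q \<noteq> 0" and u: "u \<in> - (span {p} \<union> span {q})"
  shows "connected_component_set (- (span {p} \<union> span {q})) u =
    {w. det2 p u * det2 p w > 0 \<and> det2 q u * det2 q w > 0}" (is "?C = ?P")
proof
  show "?C \<subseteq> ?P"
  proof
    fix w assume w: "w \<in> ?C"
    have conn: "connected ?C" and sub: "?C \<subseteq> - (span {p} \<union> span {q})"
      by (rule connected_connected_component connected_component_subset)+
    have uC: "u \<in> ?C" using u by (simp add: connected_component_refl)
    have "det2 r u * det2 r w > 0" if r: "r \<in> {p, q}" for r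
    proof (rule ccontr)
      assume neg: "\<not> det2 r u * det2 r w > 0"
      have "\<exists>x\<in>?C. vector [- r $ 2, r $ 1] \<bullet> x = 0"
      proof (cases "det2 r u \<le> 0")
        case True
        then show ?thesis
        proof (cases "det2 r w \<ge> 0")
          case 2: True
          then show ?thesis
            using connected_ivt_hyperplane[OF conn uC w] True by (simp add: det2_eq_inner)
        next
          case False
          then have "det2 r u = 0" using True neg by (simp add: zero_less_mult_iff)
          then show ?thesis by (intro bexI[OF _ uC]) (simp add: det2_eq_inner)
        qed
      next
        case False
        then have "det2 r w \<le> 0" using neg by (simp add: zero_less_mult_iff)
        then show ?thesis
          using connected_ivt_hyperplane[OF conn w uC] False by (simp add: det2_eq_inner)
      qed
      then obtain x where "x \<in> ?C" "det2 r x = 0" by (auto simp: det2_eq_inner)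
      then have "x \<in> span {r}" "x \<notin> span {p} \<union> span {q}"
        using mem_span_iff_det2[of r x] pq r sub by auto
      then show False using r by blast
    qed
    then show "w \<in> ?P" by simp
  qed
  have eq: "?P = {w. (det2 p u *\<^sub>R vector [- p $ 2, p $ 1]) \<bullet> w > 0} \<inter>
      {w. (det2 q u *\<^sub>R vector [- q $ 2, q $ 1]) \<bullet> w > 0}"
    by (auto simp: det2_eq_inner)
  have "convex ?P"
    unfolding eq by (intro convex_Int convex_halfspace_gt)
  moreover have "u \<in> ?P"
    using u mem_span_iff_det2 pq by (auto simp: zero_less_mult_iff linorder_neq_iff)
  moreover have "?P \<subseteq> - (span {p} \<union> span {q})"
    using mem_span_iff_det2 pq by auto
  ultimately show "?P \<subseteq> ?C"
    by (intro connected_component_maximal convex_connected)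
qed

lemma direct_neighbors_span_iff:
  assumes J: "J \<noteq> {}"
  shows "direct_neighbors (span {p}) (span {q}) ((\<lambda>j. span {x j}) ` J) \<longleftrightarrow>
    (\<forall>j\<in>J. det2 p (x j) * det2 q (x j) > 0) \<or> (\<forall>j\<in>J. det2 p (x j) * det2 q (x j) < 0)"
    (is "?L \<longleftrightarrow> ?R")
proof
  assume ?L
  then have p: "p \<noteq> 0" and q: "q \<noteq> 0" and x: "\<And>j. j \<in> J \<Longrightarrow> x j \<noteq> 0"
    by (auto simp: direct_neighbors_def is_line_span_iff)
  from \<open>?L\<close> obtain C where C: "C \<in> components (- (span {p} \<union> span {q}))"
    "\<And>j. j \<in> J \<Longrightarrow> span {x j} - {0} \<subseteq> C \<union> uminus ` C"
    by (auto simp: direct_neighbors_def)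
  from C(1) obtain u where u: "u \<in> - (span {p} \<union> span {q})"
      "C = connected_component_set (- (span {p} \<union> span {q})) u"
    by (auto simp: components_def)
  have mem: "w \<in> C \<longleftrightarrow> det2 p u * det2 p w > 0 \<and> det2 q u * det2 q w > 0" for w
    using connected_component_complement_lines[OF p q u(1)] u(2) by blast
  have "(det2 p u * det2 q u) * (det2 p (x j) * det2 q (x j)) > 0" if j: "j \<in> J" for j
  proof -
    have "x j \<in> C \<union> uminus ` C" using C(2)[OF j] x[OF j] by (auto intro: span_base)
    then have "x j \<in> C \<or> - x j \<in> C" by force
    then have "(det2 p u * det2 p (x j)) * (det2 q u * det2 q (x j)) > 0"
      unfolding mem by (auto simp: det2_minus_right intro: mult_pos_pos mult_neg_neg)
    then show ?thesis by (simp add: ac_simps)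
  qed
  then show ?R
    by (cases "det2 p u * det2 q u > 0") (auto simp: zero_less_mult_iff)
next
  assume R: ?R
  have nz: "det2 p (x j) \<noteq> 0" "det2 q (x j) \<noteq> 0" if "j \<in> J" for j
    using R that by auto
  obtain i where i: "i \<in> J" using J by blast
  have p: "p \<noteq> 0" and q: "q \<noteq> 0" and x: "\<And>j. j \<in> J \<Longrightarrow> x j \<noteq> 0"
    using nz i by (force simp: det2_def)+
  have u: "x i \<in> - (span {p} \<union> span {q})"
    using nz[OF i] mem_span_iff_det2 p q by auto
  define C where "C = connected_component_set (- (span {p} \<union> span {q})) (x i)"
  have mem: "w \<in> C \<longleftrightarrow> det2 p (x i) * det2 p w > 0 \<and> det2 q (x i) * det2 q w > 0" for w
    using connected_component_complement_lines[OF p q u] C_def by blast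
  have "C \<in> components (- (span {p} \<union> span {q}))"
    unfolding C_def using u by (rule componentsI)
  moreover have "span {x j} - {0} \<subseteq> C \<union> uminus ` C" if j: "j \<in> J" for j
  proof
    fix w assume "w \<in> span {x j} - {0}"
    then obtain c where w: "w = c *\<^sub>R x j" and c: "c \<noteq> 0" by (auto simp: span_singleton)
    have "(det2 p (x i) * det2 q (x i)) * (det2 p (x j) * det2 q (x j)) > 0"
      using R i j by (auto intro: mult_pos_pos mult_neg_neg)
    then have "c\<^sup>2 * ((det2 p (x i) * det2 q (x i)) * (det2 p (x j) * det2 q (x j))) > 0"
      using c by simp
    also have "c\<^sup>2 * ((det2 p (x i) * det2 q (x i)) * (det2 p (x j) * det2 q (x j))) =
        (det2 p (x i) * det2 p w) * (det2 q (x i) * det2 q w)"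
      by (simp add: w det2_scaleR_right power2_eq_square ac_simps)
    finally have "w \<in> C \<or> - w \<in> C"
      unfolding zero_less_mult_iff[of "det2 p (x i) * det2 p w"] mem
      by (auto simp: det2_minus_right)
    then show "w \<in> C \<union> uminus ` C" by (metis UnCI add.inverse_inverse image_eqI)
  qed
  ultimately show ?L
    using p q x by (auto simp: direct_neighbors_def is_line_span_iff)
qed

lemma det2_row_data_matrix2: "det2 (row i (data_matrix2 X)) (row j (data_matrix2 X)) = minor X i j"
  by (simp add: det2_def minor_def data_matrix2_def row_def)

section \<open>Generic observations\<close>

lemma AE_lborel_inner_neq_0:
  fixes a :: "'a::euclidean_space"
  assumes "a \<noteq> 0"
  shows "AE x in lborel. a \<bullet> x \<noteq> 0"
proof -
  have "negligible {x. a \<bullet> x = 0}" using assms by (intro negligible_hyperplane) simp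
  moreover have "{x. a \<bullet> x = 0} \<in> sets lborel"
    by (simp add: closed_hyperplane borel_closed)
  ultimately have "{x. a \<bullet> x = 0} \<in> null_sets lborel"
    by (simp add: negligible_iff_null_sets null_sets_completion_iff)
  then show ?thesis by (rule AE_I') auto
qed

lemma AE_distributed_lborel:
  assumes "distributed M lborel Z f" "AE x in lborel. P x"
  shows "AE \<omega> in M. P (Z \<omega>)"
proof (rule AE_distrD[where P = P])
  show "Z \<in> M \<rightarrow>\<^sub>M lborel" using assms(1) by (simp add: distributed_def)
  have "f \<in> borel_measurable lborel" using assms(1) by (simp add: distributed_def)
  then show "AE x in distr M lborel Z. P x"
    unfolding distributed_distr_eq_density[OF assms(1)]
    using assms(2) by (subst AE_density) auto
qed

lemma (in prob_space) AE_indep_var: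
  assumes ind: "indep_var N Y L Z"
    and meas: "Measurable.pred (N \<Otimes>\<^sub>M L) (\<lambda>(y, z). P y z)"
    and ae: "AE \<omega> in M. AE \<omega>' in M. P (Y \<omega>) (Z \<omega>')"
  shows "AE \<omega> in M. P (Y \<omega>) (Z \<omega>)"
proof -
  have Y: "Y \<in> M \<rightarrow>\<^sub>M N" and Z: "Z \<in> M \<rightarrow>\<^sub>M L"
    and eq: "distr M N Y \<Otimes>\<^sub>M distr M L Z = distr M (N \<Otimes>\<^sub>M L) (\<lambda>\<omega>. (Y \<omega>, Z \<omega>))"
    using ind unfolding indep_var_distribution_eq by auto
  note [measurable] = Y Z meas
  interpret Y: prob_space "distr M N Y" by (rule prob_space_distr) fact
  interpret Z: prob_space "distr M L Z" by (rule prob_space_distr) fact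
  interpret YZ: pair_prob_space "distr M N Y" "distr M L Z" ..
  define Q where "Q = {x \<in> space (N \<Otimes>\<^sub>M L). \<not> (case x of (y, z) \<Rightarrow> P y z)}"
  have Q: "Q \<in> sets (N \<Otimes>\<^sub>M L)" unfolding Q_def by measurable
  have "Q \<in> sets (N \<Otimes>\<^sub>M distr M L Z)"
    using Q by (simp cong: sets_pair_measure_cong)
  then have [measurable]: "(\<lambda>y. emeasure (distr M L Z) (Pair y -` Q)) \<in> borel_measurable N"
    by (rule Z.measurable_emeasure_Pair)
  have iff: "(AE z in distr M L Z. P y z) \<longleftrightarrow> emeasure (distr M L Z) (Pair y -` Q) = 0"
    if "y \<in> space N" for y
    using that sets_Pair1[OF Q, of y]
    by (intro AE_iff_measurable) (auto simp: Q_def space_pair_measure)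
  have "Measurable.pred N (\<lambda>y. emeasure (distr M L Z) (Pair y -` Q) = 0)"
    by measurable
  then have mY: "Measurable.pred N (\<lambda>y. AE z in distr M L Z. P y z)"
    by (rule measurable_cong[THEN iffD2, rotated]) (rule iff)
  have "AE \<omega> in M. AE z in distr M L Z. P (Y \<omega>) z"
    using ae AE_space
  proof eventually_elim
    case (elim \<omega>)
    have "Y \<omega> \<in> space N" by (rule measurable_space[OF Y elim(2)])
    then have "Measurable.pred L (P (Y \<omega>))" by measurable
    then show ?case using elim(1) Z by (subst AE_distr_iff) (auto simp: pred_def)
  qed
  then have "AE y in distr M N Y. AE z in distr M L Z. P y z"
    using mY Y by (subst AE_distr_iff) (auto simp: pred_def)
  then have "AE x in distr M N Y \<Otimes>\<^sub>M distr M L Z. case x of (y, z) \<Rightarrow> P y z"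
    using meas by (intro YZ.AE_pair_measure) (auto simp: pred_def space_pair_measure cong: sets_pair_measure_cong)
  then have "AE x in distr M (N \<Otimes>\<^sub>M L) (\<lambda>\<omega>. (Y \<omega>, Z \<omega>)). case x of (y, z) \<Rightarrow> P y z"
    unfolding eq .
  from AE_distrD[OF _ this] show ?thesis using Y Z by auto
qed

definition det3 :: "'p \<Rightarrow> 'p \<Rightarrow> 'p \<Rightarrow> real ^ 'p \<Rightarrow> real ^ 'p \<Rightarrow> real ^ 'p \<Rightarrow> real" where
  "det3 a b j x y z = (x $ a * y $ b - x $ b * y $ a) * z $ j
     - (x $ a * y $ j - x $ j * y $ a) * z $ b + (x $ b * y $ j - x $ j * y $ b) * z $ a"

lemma det3_kernel_trivial:
  fixes x y z :: "real ^ 'p"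
  assumes d: "det3 a b j x y z \<noteq> 0"
    and x: "\<alpha> * x $ a + \<beta> * x $ b + \<gamma> * x $ j = 0"
    and y: "\<alpha> * y $ a + \<beta> * y $ b + \<gamma> * y $ j = 0"
    and z: "\<alpha> * z $ a + \<beta> * z $ b + \<gamma> * z $ j = 0"
  shows "\<alpha> = 0 \<and> \<beta> = 0 \<and> \<gamma> = 0"
proof -
  have "\<alpha> * det3 a b j x y z = 0" "\<beta> * det3 a b j x y z = 0" "\<gamma> * det3 a b j x y z = 0"
    using x y z unfolding det3_def by algebra+
  then show ?thesis using d by simp
qed

lemma (in prob_space) AE_det3_neq_0:
  fixes X :: "nat \<Rightarrow> 'a \<Rightarrow> real ^ 'p"
  assumes ind: "indep_vars (\<lambda>_. borel) X {1..n}" and n: "n \<ge> 3"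
    and dist: "\<And>k. k \<in> {1..n} \<Longrightarrow> distributed M lborel (X k) (f k)"
    and ab: "a \<noteq> b" and j: "j \<notin> {a, b}"
  shows "AE \<omega> in M. det3 a b j (X 1 \<omega>) (X 2 \<omega>) (X 3 \<omega>) \<noteq> 0"
proof -
  have [measurable]: "(\<lambda>x. x $ i) \<in> borel_measurable borel" for i :: 'p
    by (intro borel_measurable_continuous_onI continuous_intros)
  have pred2: "Measurable.pred (PiM {1::nat} (\<lambda>_. borel) \<Otimes>\<^sub>M borel)
      (\<lambda>(y, z :: real ^ 'p). y 1 $ a * z $ b - y 1 $ b * z $ a \<noteq> 0)"
    by measurable
  have pred3: "Measurable.pred (PiM {1::nat, 2} (\<lambda>_. borel) \<Otimes>\<^sub>M borel)
      (\<lambda>(y, z :: real ^ 'p). det3 a b j (y 1) (y 2) z \<noteq> 0)"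
    unfolding det3_def by measurable
  have decouple: "AE \<omega> in M. P (restrict (\<lambda>i. X i \<omega>) A) (X k \<omega>)"
    if A: "k \<notin> A" "A \<subseteq> {1..n}" "k \<in> {1..n}"
      and P: "Measurable.pred (PiM A (\<lambda>_. borel) \<Otimes>\<^sub>M borel) (\<lambda>(y, z). P y z)"
      and ae: "AE \<omega> in M. AE z in lborel. P (restrict (\<lambda>i. X i \<omega>) A) z" for A k P
  proof -
    have "indep_var (PiM A (\<lambda>_. borel)) (\<lambda>\<omega>. restrict (\<lambda>i. X i \<omega>) A)
        (PiM {k} (\<lambda>_. borel)) (\<lambda>\<omega>. restrict (\<lambda>i. X i \<omega>) {k})"
      using A by (intro indep_var_restrict[OF ind]) auto
    moreover have "(\<lambda>(y, g). (y, g k)) \<in>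
        PiM A (\<lambda>_. borel) \<Otimes>\<^sub>M PiM {k} (\<lambda>_. borel :: (real ^ 'p) measure) \<rightarrow>\<^sub>M PiM A (\<lambda>_. borel) \<Otimes>\<^sub>M borel"
      by measurable
    from measurable_compose[OF this P]
    have "Measurable.pred (PiM A (\<lambda>_. borel) \<Otimes>\<^sub>M PiM {k} (\<lambda>_. borel :: (real ^ 'p) measure))
        (\<lambda>(y, g). P y (g k))"
      by (simp add: case_prod_beta)
    moreover have "AE \<omega> in M. AE \<omega>' in M. P (restrict (\<lambda>i. X i \<omega>) A) (restrict (\<lambda>i. X i \<omega>') {k} k)"
      using ae by eventually_elim (use AE_distributed_lborel[OF dist[OF A(3)]] in auto)
    ultimately have "AE \<omega> in M. P (restrict (\<lambda>i. X i \<omega>) A) (restrict (\<lambda>i. X i \<omega>) {k} k)"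
      by (rule AE_indep_var[where P = "\<lambda>y g. P y (g k)"])
    then show ?thesis by simp
  qed
  have lin: "AE z in lborel. c \<bullet> z \<noteq> (0::real)" if "c $ i \<noteq> 0" for c :: "real ^ 'p" and i
    using that by (intro AE_lborel_inner_neq_0) auto
  have "AE \<omega> in M. X 1 \<omega> $ a \<noteq> 0"
    using n lin[of "axis a 1" a] by (intro AE_distributed_lborel[OF dist]) (auto simp: inner_axis')
  then have "AE \<omega> in M. AE z in lborel. X 1 \<omega> $ a * z $ b - X 1 \<omega> $ b * z $ a \<noteq> 0"
  proof eventually_elim
    case (elim \<omega>)
    show ?case
      using lin[of "axis b (X 1 \<omega> $ a) - axis a (X 1 \<omega> $ b)" b] elim ab
      by (simp add: inner_diff_left inner_axis') (simp add: axis_def)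
  qed
  then have "AE \<omega> in M. X 1 \<omega> $ a * X 2 \<omega> $ b - X 1 \<omega> $ b * X 2 \<omega> $ a \<noteq> 0"
    using decouple[of 2 "{1}", OF _ _ _ pred2] n by simp
  then have "AE \<omega> in M. AE z in lborel. det3 a b j (X 1 \<omega>) (X 2 \<omega>) z \<noteq> 0"
  proof eventually_elim
    case (elim \<omega>)
    let ?x = "X 1 \<omega>" and ?y = "X 2 \<omega>"
    let ?c = "axis j (?x $ a * ?y $ b - ?x $ b * ?y $ a) - axis b (?x $ a * ?y $ j - ?x $ j * ?y $ a)
      + axis a (?x $ b * ?y $ j - ?x $ j * ?y $ b)"
    have "?c $ j \<noteq> 0" using elim j by (simp add: axis_def)
    from lin[OF this] show ?case
      by (simp add: det3_def inner_diff_left inner_add_left inner_axis')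
  qed
  then show ?thesis
    using decouple[of 3 "{1, 2}", OF _ _ _ pred3] n by simp
qed

lemma (in prob_space) AE_mle_exists_complete_bipartite:
  fixes X :: "nat \<Rightarrow> 'a \<Rightarrow> real ^ 'p"
  assumes ind: "indep_vars (\<lambda>_. borel) X {1..n}" and n: "n \<ge> 3"
    and dist: "\<And>k. k \<in> {1..n} \<Longrightarrow> distributed M lborel (X k) (f k)"
    and ab: "a \<noteq> b" and ne: "- {a, b} \<noteq> {}"
  shows "AE \<omega> in M. mle_exists (complete_bipartite {a, b} (- {a, b})) n (\<lambda>k. X k \<omega>)"
proof -
  have "AE \<omega> in M. \<forall>j\<in>- {a, b}. det3 a b j (X 1 \<omega>) (X 2 \<omega>) (X 3 \<omega>) \<noteq> 0"
    using AE_det3_neq_0[OF ind n dist ab] by (intro AE_finite_allI) auto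
  then show ?thesis
  proof eventually_elim
    case (elim \<omega>)
    show ?case
    proof (rule mle_exists_complete_bipartite[OF _ ab ne, where r = 0])
      fix j \<alpha> \<beta> \<gamma>
      assume j: "j \<notin> {a, b}" and nz: "(\<alpha>, \<beta>, \<gamma>) \<noteq> (0 :: real, 0 :: real, 0 :: real)"
      let ?y = "\<lambda>k. \<alpha> * X k \<omega> $ a + \<beta> * X k \<omega> $ b + \<gamma> * X k \<omega> $ j"
      have "(\<Sum>k=1..n. (?y k)\<^sup>2) \<noteq> 0"
      proof
        assume "(\<Sum>k=1..n. (?y k)\<^sup>2) = 0"
        then have "?y k = 0" if "k \<in> {1..n}" for k
          using that by (subst (asm) sum_nonneg_eq_0_iff) auto
        then have "?y 1 = 0" "?y 2 = 0" "?y 3 = 0" using n by auto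
        then show False
          using det3_kernel_trivial[of a b j "X 1 \<omega>" "X 2 \<omega>" "X 3 \<omega>" \<alpha> \<beta> \<gamma>] elim j nz by auto
      qed
      then have "(\<Sum>k=1..n. (?y k)\<^sup>2) > 0"
        by (simp add: order_less_le sum_nonneg)
      then show "(\<Sum>k=1..n. (?y k)\<^sup>2) + 2 * \<alpha> * \<beta> * 0 > 0" by simp
    qed (use n in simp)
  qed
qed

theorem proposition4p2:
  fixes m :: nat and v :: "nat \<Rightarrow> 'p::finite"
  assumes "m \<ge> 1"
    and "bij_betw v {1..m+2} (UNIV :: 'p set)"
  shows
    "(\<forall>n\<ge>3. \<forall>S \<in> gaussian_graphical_model (complete_bipartite (v ` {1, 2}) (v ` {3..m+2})).
        \<forall>(M :: 'w measure) (X :: nat \<Rightarrow> 'w \<Rightarrow> real ^ 'p).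
          prob_space M \<and>
          prob_space.indep_vars M (\<lambda>_. borel) X {1..n} \<and>
          (\<forall>k\<in>{1..n}. distributed M lborel (X k) (\<lambda>x. ennreal (mvn_density S x))) \<longrightarrow>
          (AE \<omega> in M. mle_exists (complete_bipartite (v ` {1, 2}) (v ` {3..m+2})) n (\<lambda>k. X k \<omega>)))
     \<and>
     (\<forall>n (X :: nat \<Rightarrow> real ^ 'p). 1 \<le> n \<and> n < 2 \<longrightarrow>
        \<not> mle_exists (complete_bipartite (v ` {1, 2}) (v ` {3..m+2})) n X)
     \<and>
     (\<forall>X :: nat \<Rightarrow> real ^ 'p.
        mle_exists (complete_bipartite (v ` {1, 2}) (v ` {3..m+2})) 2 X \<longleftrightarrow>
        direct_neighbors
          (span {row (v 1) (data_matrix2 X)})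
          (span {row (v 2) (data_matrix2 X)})
          ((\<lambda>j. span {row (v j) (data_matrix2 X)}) ` {3..m+2}))"
proof -
  have inj: "inj_on v {1..m+2}" and surj: "v ` {1..m+2} = UNIV"
    using assms(2) by (auto simp: bij_betw_def)
  have ab: "v 1 \<noteq> v 2" using inj by (auto dest: inj_onD)
  have "{3..m+2} = {1..m+2} - {1, 2}" by auto
  then have B: "v ` {3..m+2} = - {v 1, v 2}"
    using inj_on_image_set_diff[OF inj, of "{1..m+2}" "{1, 2}"] surj
    by (simp add: Compl_eq_Diff_UNIV)
  have ne: "- {v 1, v 2} \<noteq> {}" using assms(1) unfolding B[symmetric] by simp
  have E: "complete_bipartite (v ` {1, 2}) (v ` {3..m+2}) =
      complete_bipartite {v 1, v 2} (- {v 1, v 2})"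
    unfolding B by simp
  have lines: "(\<lambda>j. span {row (v j) (data_matrix2 X)}) ` {3..m+2} =
      (\<lambda>i. span {row i (data_matrix2 X)}) ` (- {v 1, v 2})" for X :: "nat \<Rightarrow> real ^ 'p"
    unfolding B[symmetric] image_image ..
  show ?thesis
    unfolding E lines direct_neighbors_span_iff[OF ne] det2_row_data_matrix2
      mle_exists_2_iff_minor[OF ab ne]
  proof (intro conjI allI ballI impI refl)
    fix n :: nat and S :: "real ^ 'p ^ 'p" and M :: "'w measure" and X :: "nat \<Rightarrow> 'w \<Rightarrow> real ^ 'p"
    assume "3 \<le> n" and *: "prob_space M \<and> prob_space.indep_vars M (\<lambda>_. borel) X {1..n} \<and>
      (\<forall>k\<in>{1..n}. distributed M lborel (X k) (\<lambda>x. ennreal (mvn_density S x)))"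
    interpret prob_space M using * by blast
    show "AE \<omega> in M. mle_exists (complete_bipartite {v 1, v 2} (- {v 1, v 2})) n (\<lambda>k. X k \<omega>)"
      using * \<open>3 \<le> n\<close> ab ne by (intro AE_mle_exists_complete_bipartite) auto
  next
    fix n :: nat and X :: "nat \<Rightarrow> real ^ 'p"
    assume "1 \<le> n \<and> n < 2"
    then have "n = 1" by simp
    then show "\<not> mle_exists (complete_bipartite {v 1, v 2} (- {v 1, v 2})) n X"
      using not_mle_exists_1[OF ne] by simp
  qed
qed

end
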